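(* Let $n,d\ge1$ and let $D=(D_i)_{i\ge0}$ be a full barcode. Then the subsets $(\mathrm{PH}^{\check{\mathrm C}})^{-1}(D)$ and $(\mathrm{PH}^{\mathrm{VR}})^{-1}(D)$ of $\mathrm{PC}_{n,d}$ are both semialgebraic, as are the subsets $(\mathrm{PH}^{\check{\mathrm C}}_i)^{-1}(D_i)$ and $(\mathrm{PH}^{\mathrm{VR}}_i)^{-1}(D_i)$ for each $i\ge0$.
   Context: Fix a field $\mathbb{F}$; $H_i$ denotes homology in degree $i$ with coefficients in $\mathbb{F}$. $\mathrm{PC}_{n,d}=\{(p_1,\dots,p_n)\in\mathbb{R}^{nd}: p_i\in\mathbb{R}^d,\ p_i\ne p_j \text{ for } i\neq j\}$; $[n]=\{1,\dots,n\}$. A barcode is a multiset of nonempty intervals in $\mathbb{R}$; a full barcode is a sequence $D=(D_i)_{i\ge0}$ of barcodes. For a filtration $\mathcal X=\{X_t\}_{t\in\mathbb{R}}$ whose persistence modules $\{H_i(X_t)\}_{t}$ are tame (pointwise finite dimensional with finitely many critical values), the degree-$i$ persistent homology is the unique (finite) multiset $D_i$ of nonempty intervals with $\{H_i(X_t)\}_t\cong\bigoplus_{I\in D_i}\chi_I$, where $\chi_I$ is the interval module of $I$; the persistent homology of $\mathcal X$ is the full barcode $(D_i)_{i\ge 0}$. For $P\in\mathrm{PC}_{n,d}$: $\mathrm{PH}^{\mathrm{VR}}_i(P)$ and $\mathrm{PH}^{\mathrm{VR}}(P)$ are the degree-$i$ persistent homology and the persistent homology of the Vietoris–Rips filtration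 $\mathrm{VR}(P,r)=\{\emptyset\ne\sigma\subseteq[n]:\|p_i-p_j\|\le 2r\ \forall i,j\in\sigma\}$, $r\in\mathbb{R}$ (empty for $r<0$). $\mathrm{PH}^{\check{\mathrm C}}_i(P)$ and $\mathrm{PH}^{\check{\mathrm C}}(P)$ are those of the Čech filtration $\{\bigcup_{i=1}^n B_r(p_i)\}_{r\in\mathbb{R}}$ by unions of closed balls of radius $r$ (empty for $r<0$), equivalently of the simplicial filtration $\{\emptyset\ne\sigma\subseteq[n]:\exists q\in\mathbb{R}^d,\ \|p_i-q\|\le r\ \forall i\in\sigma\}$. *)

theory Defs
  imports "HOL-Analysis.Analysis" "HOL-Library.Extended_Nat"
    "HOL-Algebra.Module" "HOL-Algebra.AbelCoset"
begin

section \<open>Semialgebraic sets\<close>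

text \<open>A finite union of sets, each cut out by finitely many polynomial equations \<open>f = 0\<close>
  and finitely many strict polynomial inequalities \<open>g > 0\<close>.\<close>

definition semialgebraic :: "'a::euclidean_space set \<Rightarrow> bool" where
  "semialgebraic S \<longleftrightarrow>
    (\<exists>\<C> :: (('a \<Rightarrow> real) set \<times> ('a \<Rightarrow> real) set) set.
       finite \<C> \<and>
       (\<forall>(E, G) \<in> \<C>. finite E \<and> finite G \<and> (\<forall>f \<in> E \<union> G. real_polynomial_function f)) \<and>
       S = (\<Union>(E, G) \<in> \<C>. {x. (\<forall>f \<in> E. f x = 0) \<and> (\<forall>g \<in> G. g x > 0)}))"


section \<open>Modules: isomorphisms, quotients, direct sums\<close>

text \<open>The record type for modules extends the one for rings; the fields \<open>mult\<close> and \<open>one\<close>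
  play no role for modules and are left undefined.\<close>

definition module_iso ::
  "('a, 'm) ring_scheme \<Rightarrow> ('a, 'v, 'p) module_scheme \<Rightarrow> ('a, 'w, 'q) module_scheme \<Rightarrow> ('v \<Rightarrow> 'w) set" where
  "module_iso F M N =
    {f. bij_betw f (carrier M) (carrier N) \<and>
        (\<forall>x \<in> carrier M. \<forall>y \<in> carrier M. f (x \<oplus>\<^bsub>M\<^esub> y) = f x \<oplus>\<^bsub>N\<^esub> f y) \<and>
        (\<forall>a \<in> carrier F. \<forall>x \<in> carrier M. f (a \<odot>\<^bsub>M\<^esub> x) = a \<odot>\<^bsub>N\<^esub> f x)}"

definition quotient_module ::
  "('a, 'v, 'p) module_scheme \<Rightarrow> 'v set \<Rightarrow> ('a, 'v set) module" where
  "quotient_module M B =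
    \<lparr>carrier = a_rcosets\<^bsub>M\<^esub> B, mult = undefined, one = undefined,
     zero = B, add = set_add M,
     smult = (\<lambda>a X. \<Union>x \<in> X. B +>\<^bsub>M\<^esub> (a \<odot>\<^bsub>M\<^esub> x))\<rparr>"

definition direct_sum ::
  "'i set \<Rightarrow> ('i \<Rightarrow> ('a, 'v, 'p) module_scheme) \<Rightarrow> ('a, 'i \<Rightarrow> 'v) module" where
  "direct_sum J M =
    \<lparr>carrier = {x \<in> \<Pi>\<^sub>E j \<in> J. carrier (M j). finite {j \<in> J. x j \<noteq> \<zero>\<^bsub>M j\<^esub>}},
     mult = undefined, one = undefined,
     zero = (\<lambda>j \<in> J. \<zero>\<^bsub>M j\<^esub>),
     add = (\<lambda>x y. \<lambda>j \<in> J. x j \<oplus>\<^bsub>M j\<^esub> y j),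
     smult = (\<lambda>a x. \<lambda>j \<in> J. a \<odot>\<^bsub>M j\<^esub> x j)\<rparr>"


section \<open>Persistence modules and barcodes\<close>

text \<open>A persistence module indexed by the reals. The map \<open>pm_map M s t\<close> from the space at
  \<open>s\<close> to the space at \<open>t\<close> is only relevant for \<open>s \<le> t\<close>.\<close>

record ('a, 'v) persistence_module =
  pm_space :: "real \<Rightarrow> ('a, 'v) module"
  pm_map :: "real \<Rightarrow> real \<Rightarrow> 'v \<Rightarrow> 'v"

definition pm_isomorphic ::
  "('a, 'm) ring_scheme \<Rightarrow> ('a, 'v) persistence_module \<Rightarrow> ('a, 'w) persistence_module \<Rightarrow> bool" where
  "pm_isomorphic F M N \<longleftrightarrow>
    (\<exists>\<phi>. (\<forall>t. \<phi> t \<in> module_iso F (pm_space M t) (pm_space N t)) \<and>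
         (\<forall>s t. s \<le> t \<longrightarrow> (\<forall>x \<in> carrier (pm_space M s).
            \<phi> t (pm_map M s t x) = pm_map N s t (\<phi> s x))))"

definition pm_direct_sum ::
  "'i set \<Rightarrow> ('i \<Rightarrow> ('a, 'v) persistence_module) \<Rightarrow> ('a, 'i \<Rightarrow> 'v) persistence_module" where
  "pm_direct_sum J M =
    \<lparr>pm_space = (\<lambda>t. direct_sum J (\<lambda>j. pm_space (M j) t)),
     pm_map = (\<lambda>s t x. \<lambda>j \<in> J. pm_map (M j) s t (x j))\<rparr>"

definition interval_module ::
  "('a, 'm) ring_scheme \<Rightarrow> real set \<Rightarrow> ('a, 'a) persistence_module" where
  "interval_module F I =
    \<lparr>pm_space = (\<lambda>t. \<lparr>carrier = (if t \<in> I then carrier F else {\<zero>\<^bsub>F\<^esub>}),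
        mult = undefined, one = undefined,
        zero = \<zero>\<^bsub>F\<^esub>, add = add F, smult = mult F\<rparr>),
     pm_map = (\<lambda>s t x. if s \<in> I \<and> t \<in> I then x else \<zero>\<^bsub>F\<^esub>)\<rparr>"

text \<open>A multiset of subsets of the reals is given by its multiplicity function; this allows
  infinite multisets, unlike the library type of (finite) multisets.\<close>

type_synonym interval_multiset = "real set \<Rightarrow> enat"

definition barcode :: "interval_multiset \<Rightarrow> bool" where
  "barcode B \<longleftrightarrow> (\<forall>I. B I \<noteq> 0 \<longrightarrow> is_interval I \<and> I \<noteq> {})"

definition full_barcode :: "(nat \<Rightarrow> interval_multiset) \<Rightarrow> bool" where
  "full_barcode D \<longleftrightarrow> (\<forall>i. barcode (D i))"

text \<open>The direct sum of the interval modules of \<open>B\<close>: the summands are indexed by the pairs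
  \<open>(I, k)\<close> with \<open>k < B I\<close>, so that \<open>I\<close> contributes \<open>B I\<close> copies.\<close>

definition barcode_module ::
  "('a, 'm) ring_scheme \<Rightarrow> interval_multiset \<Rightarrow> ('a, real set \<times> nat \<Rightarrow> 'a) persistence_module" where
  "barcode_module F B =
    pm_direct_sum {(I, k). enat k < B I} (\<lambda>(I, k). interval_module F I)"


section \<open>Simplicial homology\<close>

text \<open>A simplicial complex on the vertex set \<open>'n\<close> is a down-closed set of nonempty
  subsets of \<open>'n\<close>. Chains are coefficient functions on simplices, extended by zero, so that
  a subcomplex has its chains contained in those of the whole complex. The linear order of the
  vertices fixes the signs.\<close>

definition chain_module :: "('a, 'm) ring_scheme \<Rightarrow> ('a, 'n set \<Rightarrow> 'a) module" where
  "chain_module F =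
    \<lparr>carrier = {c. \<forall>\<sigma>. c \<sigma> \<in> carrier F}, mult = undefined, one = undefined,
     zero = (\<lambda>\<sigma>. \<zero>\<^bsub>F\<^esub>),
     add = (\<lambda>c c'. \<lambda>\<sigma>. c \<sigma> \<oplus>\<^bsub>F\<^esub> c' \<sigma>),
     smult = (\<lambda>a c. \<lambda>\<sigma>. a \<otimes>\<^bsub>F\<^esub> c \<sigma>)\<rparr>"

definition chains ::
  "('a, 'm) ring_scheme \<Rightarrow> 'n set set \<Rightarrow> nat \<Rightarrow> ('n set \<Rightarrow> 'a) set" where
  "chains F K i =
    {c. (\<forall>\<sigma>. c \<sigma> \<in> carrier F) \<and> (\<forall>\<sigma>. \<not> (\<sigma> \<in> K \<and> card \<sigma> = Suc i) \<longrightarrow> c \<sigma> = \<zero>\<^bsub>F\<^esub>)}"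

text \<open>From the boundary of \<open>v\<^sub>0 < \<dots> < v\<^sub>i\<close>, which is the sum of \<open>(- 1)^j\<close> times the face
  omitting \<open>v\<^sub>j\<close>: the coefficient of the boundary of \<open>c\<close> at \<open>\<tau>\<close> collects the simplices
  \<open>\<tau> \<union> {v}\<close>, in which \<open>v\<close> has position \<open>card {w \<in> \<tau>. w < v}\<close>. The empty face is
  discarded (unreduced homology).\<close>

definition boundary ::
  "('a, 'm) ring_scheme \<Rightarrow> ('n::{finite,linorder} set \<Rightarrow> 'a) \<Rightarrow> 'n set \<Rightarrow> 'a" where
  "boundary F c \<tau> =
    (if \<tau> = {} then \<zero>\<^bsub>F\<^esub>
     else finsum F (\<lambda>v. (\<ominus>\<^bsub>F\<^esub> \<one>\<^bsub>F\<^esub>) [^]\<^bsub>F\<^esub> card {w \<in> \<tau>. w < v} \<otimes>\<^bsub>F\<^esub> c (insert v \<tau>)) (- \<tau>))"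

definition cycles ::
  "('a, 'm) ring_scheme \<Rightarrow> 'n::{finite,linorder} set set \<Rightarrow> nat \<Rightarrow> ('n set \<Rightarrow> 'a) set" where
  "cycles F K i = {c \<in> chains F K i. boundary F c = (\<lambda>\<tau>. \<zero>\<^bsub>F\<^esub>)}"

definition boundaries ::
  "('a, 'm) ring_scheme \<Rightarrow> 'n::{finite,linorder} set set \<Rightarrow> nat \<Rightarrow> ('n set \<Rightarrow> 'a) set" where
  "boundaries F K i = boundary F ` chains F K (Suc i)"

definition homology ::
  "('a, 'm) ring_scheme \<Rightarrow> 'n::{finite,linorder} set set \<Rightarrow> nat \<Rightarrow> ('a, ('n set \<Rightarrow> 'a) set) module" where
  "homology F K i = quotient_module ((chain_module F)\<lparr>carrier := cycles F K i\<rparr>) (boundaries F K i)"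

text \<open>The map induced by an inclusion into \<open>L\<close>: a homology class, being a coset, is sent to
  the coset modulo the boundaries of \<open>L\<close> that contains it.\<close>

definition homology_inclusion ::
  "('a, 'm) ring_scheme \<Rightarrow> 'n::{finite,linorder} set set \<Rightarrow> nat \<Rightarrow> ('n set \<Rightarrow> 'a) set \<Rightarrow> ('n set \<Rightarrow> 'a) set" where
  "homology_inclusion F L i X = (\<Union>c \<in> X. boundaries F L i +>\<^bsub>chain_module F\<^esub> c)"


section \<open>Persistent homology of filtered complexes\<close>

definition homology_pm ::
  "('a, 'm) ring_scheme \<Rightarrow> (real \<Rightarrow> 'n::{finite,linorder} set set) \<Rightarrow> nat \<Rightarrow>
    ('a, ('n set \<Rightarrow> 'a) set) persistence_module" where
  "homology_pm F X i =
    \<lparr>pm_space = (\<lambda>t. homology F (X t) i),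
     pm_map = (\<lambda>s t. homology_inclusion F (X t) i)\<rparr>"

text \<open>The barcode \<open>B\<close> is the degree-\<open>i\<close> persistent homology of the filtration \<open>X\<close>.\<close>

definition is_PH_deg ::
  "('a, 'm) ring_scheme \<Rightarrow> (real \<Rightarrow> 'n::{finite,linorder} set set) \<Rightarrow> nat \<Rightarrow> interval_multiset \<Rightarrow> bool" where
  "is_PH_deg F X i B \<longleftrightarrow>
    barcode B \<and> pm_isomorphic F (homology_pm F X i) (barcode_module F B)"

definition is_PH ::
  "('a, 'm) ring_scheme \<Rightarrow> (real \<Rightarrow> 'n::{finite,linorder} set set) \<Rightarrow> (nat \<Rightarrow> interval_multiset) \<Rightarrow> bool" where
  "is_PH F X D \<longleftrightarrow> (\<forall>i. is_PH_deg F X i (D i))"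


section \<open>Point clouds\<close>

text \<open>Configurations of \<open>n = CARD('n)\<close> distinct labelled points in Euclidean space of dimension
  \<open>d = CARD('d)\<close>.\<close>

definition PC :: "(real ^ 'd ^ 'n) set" where
  "PC = {P. \<forall>i j. i \<noteq> j \<longrightarrow> P $ i \<noteq> P $ j}"

definition vietoris_rips :: "real ^ 'd ^ 'n \<Rightarrow> real \<Rightarrow> 'n set set" where
  "vietoris_rips P r = {\<sigma>. \<sigma> \<noteq> {} \<and> (\<forall>i \<in> \<sigma>. \<forall>j \<in> \<sigma>. norm (P $ i - P $ j) \<le> 2 * r)}"

definition cech :: "real ^ 'd ^ 'n \<Rightarrow> real \<Rightarrow> 'n set set" where
  "cech P r = {\<sigma>. \<sigma> \<noteq> {} \<and> (\<exists>q. \<forall>i \<in> \<sigma>. norm (P $ i - q) \<le> r)}"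

end

theory Submission
  imports Defs
begin

text \<open>In both filtrations a simplex \<open>\<sigma>\<close> enters at some time \<open>c \<sigma> P\<close>: half the diameter of its
  vertices, or the radius of the smallest ball enclosing them. Fix a
  configuration \<open>P0\<close> with the given barcode. A bar can start or end only at an entry time of \<open>P0\<close>
  (\<open>bar_respects_constancy\<close>). If \<open>P\<close> has the given barcode as well, and the entry times of \<open>P'\<close>
  are ordered, among themselves and relative to the entry times of \<open>P0\<close>, like those of \<open>P\<close>,
  then a monotone map \<open>h\<close> of the time axis pulls the filtration of \<open>P\<close> back to that of \<open>P'\<close>, and
  never moves a time across an entry time of \<open>P0\<close>, hence neither into nor out of a bar. The
  isomorphism with the barcode module for \<open>P\<close>, reindexed by \<open>h\<close>, is one for \<open>P'\<close>
  (\<open>is_PH_deg_reindex\<close>). So the fibre is a union of some of the finitely many cells given by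
  these comparisons, and it remains to see that \<open>c \<sigma> P \<le> c \<tau> P\<close>, \<open>c \<sigma> P \<le> e\<close> and
  \<open>e \<le> c \<sigma> P\<close> are semialgebraic conditions on \<open>P\<close> (\<open>semialgebraic_PH_fibre\<close>).

  For the Vietoris-Rips filtration these compare maxima of finitely many polynomials. For the Cech
  filtration they involve the smallest enclosing ball, and its radius is defined by a quantifier
  over centers. Quantifier elimination for linear systems whose coefficients are polynomials in
  \<open>P\<close> suffices, however, and Fourier-Motzkin elimination provides it
  (\<open>semialgebraic_exists_guarded_linear_system\<close>): the center is a convex combination of points on
  the bounding sphere, and the conditions on the weights, as well as the squared radius, become
  linear with a suitable auxiliary unknown (\<open>enclosing_certificate\<close>).\<close>


section \<open>Boolean operations on semialgebraic sets\<close>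

lemma semialgebraic_basic:
  assumes "finite E" "finite G" "\<forall>f \<in> E \<union> G. real_polynomial_function f"
  shows "semialgebraic {x. (\<forall>f\<in>E. f x = 0) \<and> (\<forall>g\<in>G. g x > 0)}"
  unfolding semialgebraic_def using assms by (intro exI[of _ "{(E, G)}"]) auto

lemma semialgebraic_eq_0:
  assumes "real_polynomial_function f"
  shows "semialgebraic {x. f x = 0}"
  using semialgebraic_basic[of "{f}" "{}"] assms by simp

lemma semialgebraic_gt_0:
  assumes "real_polynomial_function f"
  shows "semialgebraic {x. 0 < f x}"
  using semialgebraic_basic[of "{}" "{f}"] assms by simp

lemma semialgebraic_empty: "semialgebraic {}"
  unfolding semialgebraic_def by (intro exI[of _ "{}"]) auto

lemma semialgebraic_UNIV: "semialgebraic UNIV"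
  using semialgebraic_basic[of "{}" "{}"] by simp

lemma semialgebraic_Un:
  assumes "semialgebraic S" "semialgebraic T"
  shows "semialgebraic (S \<union> T)"
proof -
  obtain \<C> \<D> where
    C: "finite \<C>" "\<forall>(E, G) \<in> \<C>. finite E \<and> finite G \<and> (\<forall>f \<in> E \<union> G. real_polynomial_function f)"
      "S = (\<Union>(E, G) \<in> \<C>. {x. (\<forall>f \<in> E. f x = 0) \<and> (\<forall>g \<in> G. g x > 0)})" and
    D: "finite \<D>" "\<forall>(E, G) \<in> \<D>. finite E \<and> finite G \<and> (\<forall>f \<in> E \<union> G. real_polynomial_function f)"
      "T = (\<Union>(E, G) \<in> \<D>. {x. (\<forall>f \<in> E. f x = 0) \<and> (\<forall>g \<in> G. g x > 0)})"
    using assms unfolding semialgebraic_def by blast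
  show ?thesis
    unfolding semialgebraic_def
  proof (intro exI[of _ "\<C> \<union> \<D>"] conjI)
    show "finite (\<C> \<union> \<D>)" using C D by simp
    show "\<forall>(E, G) \<in> \<C> \<union> \<D>. finite E \<and> finite G \<and> (\<forall>f \<in> E \<union> G. real_polynomial_function f)"
      using C(2) D(2) by blast
    show "S \<union> T = (\<Union>(E, G) \<in> \<C> \<union> \<D>. {x. (\<forall>f \<in> E. f x = 0) \<and> (\<forall>g \<in> G. g x > 0)})"
      using C(3) D(3) by simp
  qed
qed

lemma semialgebraic_UN:
  assumes "finite I" "\<And>i. i \<in> I \<Longrightarrow> semialgebraic (S i)"
  shows "semialgebraic (\<Union>i\<in>I. S i)"
  using assms by (induction I rule: finite_induct) (auto intro: semialgebraic_empty semialgebraic_Un)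

lemma semialgebraic_Int:
  assumes "semialgebraic S" "semialgebraic T"
  shows "semialgebraic (S \<inter> T)"
proof -
  let ?Z = "\<lambda>(E, G). {x. (\<forall>f \<in> E. f x = 0) \<and> (\<forall>g \<in> G. g x > 0)}"
  let ?ok = "\<lambda>(E, G). finite E \<and> finite G \<and> (\<forall>f \<in> E \<union> G. real_polynomial_function f)"
  obtain \<C> \<D> where
    C: "finite \<C>" "\<forall>p \<in> \<C>. ?ok p" "S = (\<Union>p \<in> \<C>. ?Z p)" and
    D: "finite \<D>" "\<forall>p \<in> \<D>. ?ok p" "T = (\<Union>p \<in> \<D>. ?Z p)"
    using assms unfolding semialgebraic_def by blast
  have "S \<inter> T = (\<Union>(p, q) \<in> \<C> \<times> \<D>. ?Z p \<inter> ?Z q)"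
    using C(3) D(3) by blast
  moreover have "semialgebraic (?Z p \<inter> ?Z q)" if "p \<in> \<C>" "q \<in> \<D>" for p q
  proof -
    have "?Z p \<inter> ?Z q =
        {x. (\<forall>f \<in> fst p \<union> fst q. f x = 0) \<and> (\<forall>g \<in> snd p \<union> snd q. g x > 0)}"
      by (cases p; cases q) auto
    moreover have "?ok p" "?ok q" using C(2) D(2) that by blast+
    then have "semialgebraic {x. (\<forall>f \<in> fst p \<union> fst q. f x = 0) \<and> (\<forall>g \<in> snd p \<union> snd q. g x > 0)}"
      by (intro semialgebraic_basic) (auto simp: split_beta)
    ultimately show ?thesis by simp
  qed
  ultimately show ?thesis
    using C(1) D(1) by (auto intro!: semialgebraic_UN)
qed

lemma semialgebraic_INT:
  assumes "finite I" "\<And>i. i \<in> I \<Longrightarrow> semialgebraic (S i)"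
  shows "semialgebraic (\<Inter>i\<in>I. S i)"
  using assms by (induction I rule: finite_induct) (auto intro: semialgebraic_UNIV semialgebraic_Int)

lemma semialgebraic_ge_0:
  assumes "real_polynomial_function f"
  shows "semialgebraic {x. 0 \<le> f x}"
proof -
  have "{x. 0 \<le> f x} = {x. 0 < f x} \<union> {x. f x = 0}" by auto
  then show ?thesis using assms semialgebraic_Un semialgebraic_gt_0 semialgebraic_eq_0 by metis
qed

lemma semialgebraic_Compl:
  assumes "semialgebraic S"
  shows "semialgebraic (- S)"
proof -
  obtain \<C> where
    C: "finite \<C>" "\<forall>(E, G) \<in> \<C>. finite E \<and> finite G \<and> (\<forall>f \<in> E \<union> G. real_polynomial_function f)"
      "S = (\<Union>(E, G) \<in> \<C>. {x. (\<forall>f \<in> E. f x = 0) \<and> (\<forall>g \<in> G. g x > 0)})"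
    using assms unfolding semialgebraic_def by blast
  have "- S = (\<Inter>p \<in> \<C>. (\<Union>f \<in> fst p. {x. 0 < f x} \<union> {x. 0 < - f x}) \<union> (\<Union>g \<in> snd p. {x. 0 \<le> - g x}))"
    (is "_ = (\<Inter>p \<in> \<C>. ?A p)")
  proof -
    have "x \<notin> {x. (\<forall>f \<in> E. f x = 0) \<and> (\<forall>g \<in> G. g x > 0)} \<longleftrightarrow> x \<in> ?A (E, G)" for x E G
      by (auto simp: not_less linorder_neq_iff)
    then show ?thesis unfolding C(3) by (simp add: set_eq_iff split_beta)
  qed
  moreover have "semialgebraic (?A p)" if "p \<in> \<C>" for p
  proof -
    have p: "finite (fst p)" "finite (snd p)" "\<And>f. f \<in> fst p \<union> snd p \<Longrightarrow> real_polynomial_function f"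
      using C(2) that by (auto simp: split_beta)
    show ?thesis
      using p by (intro semialgebraic_Un semialgebraic_UN semialgebraic_gt_0 semialgebraic_ge_0
          real_polynomial_function_minus) simp_all
  qed
  ultimately show ?thesis using semialgebraic_INT[OF C(1), of ?A] by simp
qed

lemma semialgebraic_imp:
  assumes "semialgebraic {x. p x}" "semialgebraic {x. q x}"
  shows "semialgebraic {x. p x \<longrightarrow> q x}"
proof -
  have "{x. p x \<longrightarrow> q x} = - {x. p x} \<union> {x. q x}" by auto
  then show ?thesis using assms by (simp add: semialgebraic_Un semialgebraic_Compl)
qed

lemma semialgebraic_Ball:
  assumes "finite I" "\<And>i. i \<in> I \<Longrightarrow> semialgebraic {x. p i x}"
  shows "semialgebraic {x. \<forall>i\<in>I. p i x}"
  using semialgebraic_INT[of I "\<lambda>i. {x. p i x}"] assms by (simp add: INTER_eq)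

lemma semialgebraic_Bex:
  assumes "finite I" "\<And>i. i \<in> I \<Longrightarrow> semialgebraic {x. p i x}"
  shows "semialgebraic {x. \<exists>i\<in>I. p i x}"
  using semialgebraic_UN[of I "\<lambda>i. {x. p i x}"] assms by (simp add: UNION_eq)

text \<open>A set is a Boolean combination of finitely many sets as soon as membership in these sets
  decides membership in it: it is then the union of the cells that it meets, one for each subset
  of the index set.\<close>

lemma semialgebraic_if_decided:
  assumes "finite I" and "\<And>i. i \<in> I \<Longrightarrow> semialgebraic {x. p i x}"
    and "semialgebraic S" and "T \<subseteq> S"
    and decided: "\<And>x y. x \<in> T \<Longrightarrow> y \<in> S \<Longrightarrow> \<forall>i\<in>I. p i x \<longleftrightarrow> p i y \<Longrightarrow> y \<in> T"
  shows "semialgebraic T"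
proof -
  define cell where "cell J = {y. \<forall>i\<in>I. p i y \<longleftrightarrow> i \<in> J}" for J
  have "semialgebraic (cell J)" for J
  proof -
    have "semialgebraic {y. p i y \<longleftrightarrow> i \<in> J}" if "i \<in> I" for i
    proof (cases "i \<in> J")
      case True
      then show ?thesis using assms(2)[OF that] by simp
    next
      case False
      then show ?thesis
        using semialgebraic_Compl[OF assms(2)[OF that]] by (simp add: Compl_eq)
    qed
    then show ?thesis unfolding cell_def using assms(1) by (auto intro: semialgebraic_Ball)
  qed
  moreover have "T = S \<inter> (\<Union>J \<in> {J \<in> Pow I. T \<inter> cell J \<noteq> {}}. cell J)"
  proof (intro equalityI subsetI)
    fix x assume "x \<in> T"
    moreover have "x \<in> cell {i \<in> I. p i x}" by (auto simp: cell_def)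
    moreover have "{i \<in> I. p i x} \<in> Pow I" by blast
    ultimately have "{i \<in> I. p i x} \<in> {J \<in> Pow I. T \<inter> cell J \<noteq> {}}" by blast
    then show "x \<in> S \<inter> (\<Union>J \<in> {J \<in> Pow I. T \<inter> cell J \<noteq> {}}. cell J)"
      using assms(4) \<open>x \<in> T\<close> \<open>x \<in> cell {i \<in> I. p i x}\<close> by (meson IntI UN_I subsetD)
  next
    fix y assume "y \<in> S \<inter> (\<Union>J \<in> {J \<in> Pow I. T \<inter> cell J \<noteq> {}}. cell J)"
    then obtain J where "T \<inter> cell J \<noteq> {}" "y \<in> cell J" "y \<in> S" by auto
    then obtain x where "x \<in> T" "x \<in> cell J" by blast
    then show "y \<in> T"
      using decided[of x y] \<open>y \<in> cell J\<close> \<open>y \<in> S\<close> by (simp add: cell_def)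
  qed
  moreover have "finite {J \<in> Pow I. T \<inter> cell J \<noteq> {}}" using assms(1) by simp
  ultimately show ?thesis
    using semialgebraic_Int[OF assms(3) semialgebraic_UN[of "{J \<in> Pow I. T \<inter> cell J \<noteq> {}}" cell]]
    by simp
qed


section \<open>Eliminating quantifiers over linear variables\<close>

text \<open>Fourier-Motzkin elimination of one real variable: constraints with positive \<open>\<alpha>\<close> are lower
  bounds for \<open>y\<close>, those with negative \<open>\<alpha>\<close> are upper bounds, and a solution exists when no
  lower bound exceeds an upper bound.\<close>

lemma fourier_motzkin:
  fixes \<alpha> \<beta> :: "'c \<Rightarrow> real"
  assumes "finite C"
  shows "(\<exists>y. \<forall>c\<in>C. 0 \<le> \<beta> c + \<alpha> c * y) \<longleftrightarrow>
    (\<forall>c\<in>C. \<alpha> c = 0 \<longrightarrow> 0 \<le> \<beta> c) \<and>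
    (\<forall>c\<in>C. \<forall>d\<in>C. 0 < \<alpha> c \<longrightarrow> \<alpha> d < 0 \<longrightarrow> 0 \<le> \<alpha> c * \<beta> d - \<alpha> d * \<beta> c)"
    (is "?L \<longleftrightarrow> ?R")
proof
  assume ?L
  then obtain y where y: "\<forall>c\<in>C. 0 \<le> \<beta> c + \<alpha> c * y" by blast
  have "0 \<le> \<alpha> c * \<beta> d - \<alpha> d * \<beta> c" if "c \<in> C" "d \<in> C" "0 < \<alpha> c" "\<alpha> d < 0" for c d
  proof -
    have "0 \<le> \<alpha> c * (\<beta> d + \<alpha> d * y)" "0 \<le> - \<alpha> d * (\<beta> c + \<alpha> c * y)"
      using y that by (intro mult_nonneg_nonneg; simp)+
    then have "0 \<le> \<alpha> c * (\<beta> d + \<alpha> d * y) + - \<alpha> d * (\<beta> c + \<alpha> c * y)" by linarith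
    then show ?thesis by (simp add: algebra_simps)
  qed
  moreover have "0 \<le> \<beta> c" if "c \<in> C" "\<alpha> c = 0" for c using y that by fastforce
  ultimately show ?R by blast
next
  assume R: ?R
  let ?P = "{c\<in>C. 0 < \<alpha> c}" and ?N = "{c\<in>C. \<alpha> c < 0}"
  let ?b = "\<lambda>c. - \<beta> c / \<alpha> c"
  have le: "?b c \<le> ?b d" if "c \<in> ?P" "d \<in> ?N" for c d
    using R that by (auto simp: field_simps)
  obtain y where y: "\<forall>c\<in>?P. ?b c \<le> y" "\<forall>d\<in>?N. y \<le> ?b d"
  proof (cases "?P = {}")
    case True
    have "\<exists>y. \<forall>d\<in>?N. y \<le> ?b d"
    proof (cases "?N = {}")
      case False
      then show ?thesis using assms by (intro exI[of _ "Min (?b ` ?N)"]) auto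
    qed auto
    then show thesis using that unfolding True by blast
  next
    case False
    show thesis
    proof (rule that)
      show "\<forall>c\<in>?P. ?b c \<le> Max (?b ` ?P)" using assms by auto
      show "\<forall>d\<in>?N. Max (?b ` ?P) \<le> ?b d" using assms False le by (subst Max_le_iff) auto
    qed
  qed
  have "0 \<le> \<beta> c + \<alpha> c * y" if "c \<in> C" for c
  proof -
    consider "0 < \<alpha> c" | "\<alpha> c < 0" | "\<alpha> c = 0" by linarith
    then show ?thesis
    proof cases
      case 1
      then have "?b c \<le> y" using y that by blast
      then show ?thesis using 1 by (simp add: field_simps)
    next
      case 2
      then have "y \<le> ?b c" using y that by blast
      then show ?thesis using 2 by (simp add: field_simps)
    next
      case 3
      then show ?thesis using R that by simp
    qed
  qed
  then show ?L by blast
qed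

text \<open>The sign of the coefficient of a variable depends on the parameter, and with it the
  system that remains after the elimination. Letting every inequality be imposed only for
  parameters in a semialgebraic guard turns this case distinction into part of the new system,
  and keeps the induction on the number of variables uniform.\<close>

lemma semialgebraic_exists_guarded_linear_system:
  fixes C :: "('a::euclidean_space set \<times> ('k \<Rightarrow> 'a \<Rightarrow> real) \<times> ('a \<Rightarrow> real)) set"
  assumes "finite V" "finite C"
    and "\<forall>(g, a, b) \<in> C. semialgebraic g \<and> (\<forall>k. real_polynomial_function (a k)) \<and> real_polynomial_function b"
  shows "semialgebraic {P. \<exists>x. \<forall>(g, a, b) \<in> C. P \<in> g \<longrightarrow> 0 \<le> b P + (\<Sum>k\<in>V. a k P * x k)}"
  using assms
proof (induction V arbitrary: C rule: finite_induct)
  case empty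
  have "semialgebraic {P. \<forall>c\<in>C. P \<in> fst c \<longrightarrow> 0 \<le> snd (snd c) P}"
    using empty by (intro semialgebraic_Ball semialgebraic_imp semialgebraic_ge_0) auto
  then show ?case by (simp add: split_beta)
next
  case (insert v V)
  define C1 where "C1 = (\<lambda>(g, a, b). (g \<inter> {P. a v P = 0}, a, b)) ` C"
  define C2 where "C2 = (\<lambda>((g, a, b), (g', a', b')).
      (g \<inter> g' \<inter> {P. 0 < a v P} \<inter> {P. 0 < - a' v P},
       \<lambda>k P. a v P * a' k P - a' v P * a k P,
       \<lambda>P. a v P * b' P - a' v P * b P)) ` (C \<times> C)"
  have ok: "semialgebraic g" "real_polynomial_function (a k)" "real_polynomial_function b"
    if "(g, a, b) \<in> C" for g a b k using insert.prems that by auto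
  have "semialgebraic {P. \<exists>x. \<forall>(g, a, b) \<in> C1 \<union> C2. P \<in> g \<longrightarrow> 0 \<le> b P + (\<Sum>k\<in>V. a k P * x k)}"
  proof (rule insert.IH)
    show "finite (C1 \<union> C2)" using insert.prems by (simp add: C1_def C2_def)
    show "\<forall>(g, a, b) \<in> C1 \<union> C2.
        semialgebraic g \<and> (\<forall>k. real_polynomial_function (a k)) \<and> real_polynomial_function b"
      unfolding C1_def C2_def
      by (auto simp del: neg_0_less_iff_less intro!: semialgebraic_Int semialgebraic_eq_0 semialgebraic_gt_0
          real_polynomial_function_diff real_polynomial_function_minus
          real_polynomial_function.intros(4) dest: ok)
  qed
  moreover have "(\<exists>x. \<forall>(g, a, b) \<in> C. P \<in> g \<longrightarrow> 0 \<le> b P + (\<Sum>k\<in>insert v V. a k P * x k)) \<longleftrightarrow>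
      (\<exists>x. \<forall>(g, a, b) \<in> C1 \<union> C2. P \<in> g \<longrightarrow> 0 \<le> b P + (\<Sum>k\<in>V. a k P * x k))"
    (is "?L \<longleftrightarrow> ?R") for P
  proof -
    let ?C = "{c\<in>C. P \<in> fst c}"
    let ?\<alpha> = "\<lambda>c. fst (snd c) v P :: real"
    let ?\<beta> = "\<lambda>(x :: 'k \<Rightarrow> real) c. snd (snd c) P + (\<Sum>k\<in>V. fst (snd c) k P * x k)"
    have "?L \<longleftrightarrow> (\<exists>x. \<exists>y. \<forall>c\<in>?C. 0 \<le> ?\<beta> x c + ?\<alpha> c * y)"
    proof
      assume ?L
      then obtain x where "\<forall>(g, a, b) \<in> C. P \<in> g \<longrightarrow> 0 \<le> b P + (\<Sum>k\<in>insert v V. a k P * x k)" ..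
      then have "\<forall>c\<in>?C. 0 \<le> ?\<beta> x c + ?\<alpha> c * x v"
        using insert.hyps by (auto simp: algebra_simps split_beta)
      then show "\<exists>x. \<exists>y. \<forall>c\<in>?C. 0 \<le> ?\<beta> x c + ?\<alpha> c * y" by blast
    next
      assume "\<exists>x. \<exists>y. \<forall>c\<in>?C. 0 \<le> ?\<beta> x c + ?\<alpha> c * y"
      then obtain x y where xy: "\<forall>c\<in>?C. 0 \<le> ?\<beta> x c + ?\<alpha> c * y" by blast
      have upd: "(\<Sum>k\<in>V. a k P * (x(v := y)) k) = (\<Sum>k\<in>V. a k P * x k)" for a :: "'k \<Rightarrow> 'a \<Rightarrow> real"
        using insert.hyps by (intro sum.cong) auto
      show ?L
      proof (intro exI[of _ "x(v := y)"] ballI, clarify)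
        fix g a b assume "(g, a, b) \<in> C" "P \<in> g"
        then have "0 \<le> b P + (\<Sum>k\<in>V. a k P * x k) + a v P * y" using xy by fastforce
        then show "0 \<le> b P + (\<Sum>k\<in>insert v V. a k P * (x(v := y)) k)"
          using insert.hyps upd[of a] by (simp add: algebra_simps)
      qed
    qed
    also have "\<dots> \<longleftrightarrow> (\<exists>x. (\<forall>c\<in>?C. ?\<alpha> c = 0 \<longrightarrow> 0 \<le> ?\<beta> x c) \<and>
        (\<forall>c\<in>?C. \<forall>d\<in>?C. 0 < ?\<alpha> c \<longrightarrow> ?\<alpha> d < 0 \<longrightarrow> 0 \<le> ?\<alpha> c * ?\<beta> x d - ?\<alpha> d * ?\<beta> x c))"
      using insert.prems by (subst fourier_motzkin) auto
    also have "\<dots> \<longleftrightarrow> ?R"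
    proof -
      have 1: "(\<forall>c\<in>?C. ?\<alpha> c = 0 \<longrightarrow> 0 \<le> ?\<beta> x c) \<longleftrightarrow>
          (\<forall>(g, a, b) \<in> C1. P \<in> g \<longrightarrow> 0 \<le> b P + (\<Sum>k\<in>V. a k P * x k))" for x
        unfolding C1_def by (auto simp: split_beta)
      have comb: "?\<alpha> c * ?\<beta> x d - ?\<alpha> d * ?\<beta> x c =
          (?\<alpha> c * snd (snd d) P - ?\<alpha> d * snd (snd c) P) +
          (\<Sum>k\<in>V. (?\<alpha> c * fst (snd d) k P - ?\<alpha> d * fst (snd c) k P) * x k)" for x c d
      proof -
        have "(\<Sum>k\<in>V. (?\<alpha> c * fst (snd d) k P - ?\<alpha> d * fst (snd c) k P) * x k) =
            ?\<alpha> c * (\<Sum>k\<in>V. fst (snd d) k P * x k) - ?\<alpha> d * (\<Sum>k\<in>V. fst (snd c) k P * x k)"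
          by (simp only: left_diff_distrib sum_subtractf sum_distrib_left mult.assoc)
        then show ?thesis by (simp only: distrib_left)
      qed
      have 2: "(\<forall>c\<in>?C. \<forall>d\<in>?C. 0 < ?\<alpha> c \<longrightarrow> ?\<alpha> d < 0 \<longrightarrow> 0 \<le> ?\<alpha> c * ?\<beta> x d - ?\<alpha> d * ?\<beta> x c) \<longleftrightarrow>
          (\<forall>(g, a, b) \<in> C2. P \<in> g \<longrightarrow> 0 \<le> b P + (\<Sum>k\<in>V. a k P * x k))" for x
        unfolding C2_def comb by (simp add: split_beta del: split_paired_All) blast
      show ?thesis unfolding 1 2 ball_Un ..
    qed
    finally show ?thesis .
  qed
  ultimately show ?case by simp
qed

definition parametric_affine :: "('a::euclidean_space \<Rightarrow> ('k::finite \<Rightarrow> real) \<Rightarrow> real) \<Rightarrow> bool" where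
  "parametric_affine f \<longleftrightarrow>
    (\<exists>a b. (\<forall>k. real_polynomial_function (a k)) \<and> real_polynomial_function b \<and>
       f = (\<lambda>P x. b P + (\<Sum>k\<in>UNIV. a k P * x k)))"

lemma parametric_affine_parameter:
  "real_polynomial_function b \<Longrightarrow> parametric_affine (\<lambda>P x. b P)"
  unfolding parametric_affine_def by (intro exI[of _ "\<lambda>k P. 0"] exI[of _ b]) auto

lemma parametric_affine_variable:
  "parametric_affine (\<lambda>P x. x k)"
  unfolding parametric_affine_def
proof (intro exI[of _ "\<lambda>i P. if i = k then 1 else 0"] exI[of _ "\<lambda>P. 0"] conjI)
  show "\<forall>i. real_polynomial_function (\<lambda>P::'a. if i = k then 1 else (0::real))"
    by (simp add: real_polynomial_function.intros(2))
qed (auto simp: if_distrib[of "\<lambda>t. t * _"] cong: if_cong)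

lemma parametric_affine_add:
  assumes "parametric_affine f" "parametric_affine g"
  shows "parametric_affine (\<lambda>P x. f P x + g P x)"
proof -
  obtain a b a' b' where *: "\<forall>k. real_polynomial_function (a k)" "real_polynomial_function b"
      "f = (\<lambda>P x. b P + (\<Sum>k\<in>UNIV. a k P * x k))"
      "\<forall>k. real_polynomial_function (a' k)" "real_polynomial_function b'"
      "g = (\<lambda>P x. b' P + (\<Sum>k\<in>UNIV. a' k P * x k))"
    using assms unfolding parametric_affine_def by blast
  show ?thesis
    unfolding parametric_affine_def
    by (rule exI[of _ "\<lambda>k P. a k P + a' k P"], rule exI[of _ "\<lambda>P. b P + b' P"])
      (use * in \<open>auto simp: sum.distrib algebra_simps fun_eq_iff\<close>)
qed

lemma parametric_affine_scale:
  assumes "real_polynomial_function c" "parametric_affine f"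
  shows "parametric_affine (\<lambda>P x. c P * f P x)"
proof -
  obtain a b where *: "\<forall>k. real_polynomial_function (a k)" "real_polynomial_function b"
      "f = (\<lambda>P x. b P + (\<Sum>k\<in>UNIV. a k P * x k))"
    using assms unfolding parametric_affine_def by blast
  show ?thesis
    unfolding parametric_affine_def
    by (rule exI[of _ "\<lambda>k P. c P * a k P"], rule exI[of _ "\<lambda>P. c P * b P"])
      (use * assms(1) in \<open>auto simp: sum_distrib_left algebra_simps fun_eq_iff\<close>)
qed

lemma parametric_affine_diff:
  assumes "parametric_affine f" "parametric_affine g"
  shows "parametric_affine (\<lambda>P x. f P x - g P x)"
  using parametric_affine_add[OF assms(1) parametric_affine_scale[OF _ assms(2), of "\<lambda>P. - 1"]]
  by (simp add: real_polynomial_function.intros(2))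

lemma parametric_affine_sum:
  assumes "finite I" "\<And>i. i \<in> I \<Longrightarrow> parametric_affine (f i)"
  shows "parametric_affine (\<lambda>P x. \<Sum>i\<in>I. f i P x)"
  using assms
  by (induction I rule: finite_induct)
    (auto intro!: parametric_affine_add parametric_affine_parameter real_polynomial_function.intros(2))

lemma semialgebraic_exists_affine_system:
  fixes \<Phi> :: "('a::euclidean_space \<Rightarrow> ('k::finite \<Rightarrow> real) \<Rightarrow> real) set"
  assumes "finite \<Phi>" and "\<And>f. f \<in> \<Phi> \<Longrightarrow> parametric_affine f"
  shows "semialgebraic {P. \<exists>x. \<forall>f\<in>\<Phi>. 0 \<le> f P x}"
proof -
  have "\<forall>f\<in>\<Phi>. \<exists>a b. (\<forall>k. real_polynomial_function (a k)) \<and> real_polynomial_function b \<and>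
       f = (\<lambda>P x. b P + (\<Sum>k\<in>UNIV. a k P * x k))"
    using assms(2) unfolding parametric_affine_def by blast
  then obtain a b where ab: "\<forall>f\<in>\<Phi>. (\<forall>k. real_polynomial_function (a f k)) \<and>
      real_polynomial_function (b f) \<and> f = (\<lambda>P x. b f P + (\<Sum>k\<in>UNIV. a f k P * x k))"
    by metis
  then have eval: "f P x = b f P + (\<Sum>k\<in>UNIV. a f k P * x k)" if "f \<in> \<Phi>" for f P x
    using that by metis
  have "semialgebraic {P. \<exists>x. \<forall>(g, a', b') \<in> (\<lambda>f. (UNIV, a f, b f)) ` \<Phi>.
      P \<in> g \<longrightarrow> 0 \<le> b' P + (\<Sum>k\<in>UNIV. a' k P * x k)}"
    by (rule semialgebraic_exists_guarded_linear_system)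
      (use assms(1) ab in \<open>auto simp: semialgebraic_UNIV\<close>)
  then show ?thesis by (simp add: eval)
qed


section \<open>Persistence modules of filtrations that change at finitely many times\<close>

lemma abelian_group_chain_module:
  assumes "field F"
  shows "abelian_group (chain_module F :: ('a, 'n set \<Rightarrow> 'a) module)"
proof -
  interpret field F by fact
  show ?thesis
  proof (rule abelian_groupI)
    fix x :: "'n set \<Rightarrow> 'a"
    assume "x \<in> carrier (chain_module F)"
    then show "\<exists>y\<in>carrier (chain_module F). y \<oplus>\<^bsub>chain_module F\<^esub> x = \<zero>\<^bsub>chain_module F\<^esub>"
      by (intro bexI[of _ "\<lambda>\<sigma>. \<ominus>\<^bsub>F\<^esub> x \<sigma>"]) (auto simp: chain_module_def l_neg)
  qed (auto simp: chain_module_def a_ac)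
qed

lemma boundary_closed:
  fixes c :: "'n::{finite,linorder} set \<Rightarrow> 'a"
  assumes "field F" "\<And>\<sigma>. c \<sigma> \<in> carrier F"
  shows "boundary F c \<tau> \<in> carrier F"
proof -
  interpret field F by fact
  show ?thesis using assms(2) by (auto simp: boundary_def intro!: finsum_closed)
qed

lemma boundary_add:
  fixes c c' :: "'n::{finite,linorder} set \<Rightarrow> 'a"
  assumes "field F" "\<And>\<sigma>. c \<sigma> \<in> carrier F" "\<And>\<sigma>. c' \<sigma> \<in> carrier F"
  shows "boundary F (\<lambda>\<sigma>. c \<sigma> \<oplus>\<^bsub>F\<^esub> c' \<sigma>) \<tau> = boundary F c \<tau> \<oplus>\<^bsub>F\<^esub> boundary F c' \<tau>"
proof -
  interpret field F by fact
  show ?thesis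
  proof (cases "\<tau> = {}")
    case False
    then show ?thesis
      using assms(2,3) by (simp add: boundary_def r_distr Pi_def flip: finsum_addf)
  qed (simp add: boundary_def)
qed

lemma subgroup_boundaries:
  fixes K :: "'n::{finite,linorder} set set"
  assumes "field F"
  shows "subgroup (boundaries F K i) (add_monoid (chain_module F))"
proof -
  interpret field F by fact
  let ?M = "add_monoid (chain_module F :: ('a, 'n set \<Rightarrow> 'a) module)"
  interpret A: abelian_group "chain_module F :: ('a, 'n set \<Rightarrow> 'a) module"
    by (rule abelian_group_chain_module) fact
  have "group_hom ?M ?M (boundary F)"
    by (intro group_hom.intro A.a_group group_hom_axioms.intro homI)
      (auto simp: chain_module_def boundary_closed boundary_add \<open>field F\<close> fun_eq_iff)
  moreover have "subgroup (chains F K (Suc i)) ?M"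
  proof (rule group.subgroupI[OF A.a_group])
    show "chains F K (Suc i) \<noteq> {}"
      by (auto simp: chains_def intro!: exI[of _ "\<lambda>\<sigma>. \<zero>\<^bsub>F\<^esub>"])
    fix c assume c: "c \<in> chains F K (Suc i)"
    have "inv\<^bsub>?M\<^esub> c = (\<lambda>\<sigma>. \<ominus>\<^bsub>F\<^esub> c \<sigma>)"
      using c by (intro group.inv_equality[OF A.a_group])
        (auto simp: chains_def chain_module_def l_neg)
    then show "inv\<^bsub>?M\<^esub> c \<in> chains F K (Suc i)" using c by (auto simp: chains_def)
  qed (auto simp: chains_def chain_module_def)
  ultimately show ?thesis
    unfolding boundaries_def by (rule group_hom.subgroup_img_is_subgroup)
qed

text \<open>The image of a coset is the union of the cosets of its members; within one complex these
  members represent the same class, so all these cosets coincide.\<close>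

lemma homology_inclusion_self:
  fixes K :: "'n::{finite,linorder} set set"
  assumes "field F" and X: "X \<in> carrier (homology F K i)"
  shows "homology_inclusion F K i X = X"
proof -
  let ?M = "add_monoid (chain_module F :: ('a, 'n set \<Rightarrow> 'a) module)"
  interpret A: group ?M
    using abelian_group.a_group[OF abelian_group_chain_module[OF assms(1)]] .
  let ?B = "boundaries F K i"
  have B: "subgroup ?B ?M" by (rule subgroup_boundaries) fact
  obtain c where c: "c \<in> cycles F K i" and Xc: "X = ?B #>\<^bsub>?M\<^esub> c"
    using X by (auto simp: homology_def quotient_module_def A_RCOSETS_def RCOSETS_def r_coset_def)
  have "c \<in> carrier ?M" using c by (auto simp: cycles_def chains_def chain_module_def)
  then have "c \<in> X" and "\<And>c'. c' \<in> X \<Longrightarrow> ?B #>\<^bsub>?M\<^esub> c' = X"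
    using A.rcos_self[OF _ B] A.repr_independence[OF _ _ B] unfolding Xc by auto
  then show ?thesis
    by (auto simp: homology_inclusion_def a_r_coset_def)
qed

lemma is_PH_degE:
  assumes "is_PH_deg F X i B"
  obtains \<phi> where "\<And>t. \<phi> t \<in> module_iso F (homology F (X t) i) (pm_space (barcode_module F B) t)"
    and "\<And>s t x. s \<le> t \<Longrightarrow> x \<in> carrier (homology F (X s) i) \<Longrightarrow>
        \<phi> t (homology_inclusion F (X t) i x) = pm_map (barcode_module F B) s t (\<phi> s x)"
proof -
  from assms obtain \<phi> where "(\<forall>t. \<phi> t \<in> module_iso F (homology F (X t) i) (pm_space (barcode_module F B) t)) \<and>
      (\<forall>s t. s \<le> t \<longrightarrow> (\<forall>x \<in> carrier (homology F (X s) i).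
        \<phi> t (homology_inclusion F (X t) i x) = pm_map (barcode_module F B) s t (\<phi> s x)))"
    unfolding is_PH_deg_def pm_isomorphic_def homology_pm_def persistence_module.simps by blast
  then show thesis using that[of \<phi>] by simp
qed

text \<open>If the complexes at two times agree, so do their homologies, and the map between them is
  the identity. A bar containing only one of the two times would make the corresponding map of
  the barcode module non-injective (if the bar ends) or non-surjective (if it starts).\<close>

lemma bar_respects_constancy:
  fixes X :: "real \<Rightarrow> 'n::{finite,linorder} set set"
  assumes "field F" and PH: "is_PH_deg F X i B" and I: "B I \<noteq> 0" and X: "X s = X t"
  shows "s \<in> I \<longleftrightarrow> t \<in> I"
proof -
  interpret field F by fact
  let ?J = "{(I, k). enat k < B I}"
  let ?N = "barcode_module F B"
  obtain \<phi> where iso: "\<And>t. \<phi> t \<in> module_iso F (homology F (X t) i) (pm_space ?N t)"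
    and nat: "\<And>s t x. s \<le> t \<Longrightarrow> x \<in> carrier (homology F (X s) i) \<Longrightarrow>
        \<phi> t (homology_inclusion F (X t) i x) = pm_map ?N s t (\<phi> s x)"
    using is_PH_degE[OF PH] by blast
  have bij: "bij_betw (\<phi> t) (carrier (homology F (X t) i)) (carrier (pm_space ?N t))" for t
    using iso by (simp add: module_iso_def)
  have onto: "\<exists>x\<in>carrier (homology F (X t) i). \<phi> t x = y" if "y \<in> carrier (pm_space ?N t)" for t y
    using bij_betw_imp_surj_on[OF bij[of t]] that by (metis imageE)
  have j: "(I, 0) \<in> ?J" using I by (simp add: zero_enat_def flip: neq0_conv) (metis i0_less zero_enat_def)
  define unit_at where "unit_at t = (\<lambda>j\<in>?J. if j = (I, 0) \<and> t \<in> I then \<one>\<^bsub>F\<^esub> else \<zero>\<^bsub>F\<^esub>)" for t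
  define zero_vec where "zero_vec = (\<lambda>j\<in>?J. \<zero>\<^bsub>F\<^esub>)"
  have in_N: "unit_at t \<in> carrier (pm_space ?N t)" "zero_vec \<in> carrier (pm_space ?N t)" for t
  proof -
    have "finite {j \<in> ?J. unit_at t j \<noteq> \<zero>\<^bsub>F\<^esub>}"
      by (rule finite_subset[of _ "{(I, 0)}"]) (auto simp: unit_at_def)
    then show "unit_at t \<in> carrier (pm_space ?N t)" "zero_vec \<in> carrier (pm_space ?N t)"
      by (auto simp: barcode_module_def pm_direct_sum_def direct_sum_def interval_module_def
          unit_at_def zero_vec_def split_beta cong: conj_cong split: if_splits)
  qed
  have "s \<in> I \<longleftrightarrow> t \<in> I" if "s \<le> t" and X: "X s = X t" for s t
  proof -
    have agree: "\<phi> t x = pm_map ?N s t (\<phi> s x)" if "x \<in> carrier (homology F (X s) i)" for x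
      using nat[OF \<open>s \<le> t\<close> that] homology_inclusion_self[OF assms(1), of x "X t" i] that X by simp
    have "t \<in> I" if "s \<in> I"
    proof (rule ccontr)
      assume "t \<notin> I"
      obtain x y where x: "x \<in> carrier (homology F (X s) i)" "\<phi> s x = unit_at s"
        and y: "y \<in> carrier (homology F (X s) i)" "\<phi> s y = zero_vec"
        using onto in_N by metis
      have "pm_map ?N s t (unit_at s) = pm_map ?N s t zero_vec"
        using \<open>t \<notin> I\<close> by (auto simp: barcode_module_def pm_direct_sum_def interval_module_def
          unit_at_def zero_vec_def split_beta fun_eq_iff)
      then have "\<phi> t x = \<phi> t y" using agree x y by simp
      then have "x = y" using inj_onD[OF bij_betw_imp_inj_on[OF bij[of t]]] x(1) y(1) X by simp
      then have "unit_at s (I, 0) = zero_vec (I, 0)" using x(2) y(2) by simp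
      then show False using j that by (simp add: unit_at_def zero_vec_def)
    qed
    moreover have "s \<in> I" if "t \<in> I"
    proof (rule ccontr)
      assume "s \<notin> I"
      obtain x where x: "x \<in> carrier (homology F (X s) i)" "\<phi> t x = unit_at t"
        using onto[OF in_N(1)[of t]] X by auto
      then have "unit_at t (I, 0) = pm_map ?N s t (\<phi> s x) (I, 0)" using agree by metis
      also have "\<dots> = \<zero>\<^bsub>F\<^esub>"
        using \<open>s \<notin> I\<close> j by (simp add: barcode_module_def pm_direct_sum_def interval_module_def)
      finally show False using j that by (simp add: unit_at_def)
    qed
    ultimately show ?thesis by blast
  qed
  from this[of s t] this[of t s] X show ?thesis by (metis linear)
qed

text \<open>Reindexing the isomorphism by \<open>h\<close>: when the bars do not separate \<open>t\<close> from \<open>h t\<close>, the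
  barcode module pulled back along \<open>h\<close> is again the barcode module.\<close>

lemma is_PH_deg_reindex:
  fixes X X' :: "real \<Rightarrow> 'n::{finite,linorder} set set"
  assumes PH: "is_PH_deg F X i B" and "mono h" and X': "\<And>t. X' t = X (h t)"
    and bars: "\<And>I t. B I \<noteq> 0 \<Longrightarrow> h t \<in> I \<longleftrightarrow> t \<in> I"
  shows "is_PH_deg F X' i B"
proof -
  let ?N = "barcode_module F B"
  have bar: "h t \<in> I \<longleftrightarrow> t \<in> I" if "enat k < B I" for I k t
  proof -
    have "B I \<noteq> 0" using that by auto
    then show ?thesis by (rule bars)
  qed
  have space: "pm_space ?N (h t) = pm_space ?N t" for t
    by (auto simp: barcode_module_def pm_direct_sum_def direct_sum_def interval_module_def
        split_beta bar fun_eq_iff PiE_iff)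
  have map: "pm_map ?N (h s) (h t) = pm_map ?N s t" for s t
    by (auto simp: barcode_module_def pm_direct_sum_def interval_module_def
        split_beta bar fun_eq_iff restrict_def)
  obtain \<phi> where iso: "\<And>t. \<phi> t \<in> module_iso F (homology F (X t) i) (pm_space ?N t)"
    and nat: "\<And>s t x. s \<le> t \<Longrightarrow> x \<in> carrier (homology F (X s) i) \<Longrightarrow>
        \<phi> t (homology_inclusion F (X t) i x) = pm_map ?N s t (\<phi> s x)"
    using is_PH_degE[OF PH] by blast
  have "pm_isomorphic F (homology_pm F X' i) ?N"
    unfolding pm_isomorphic_def homology_pm_def
  proof (intro exI[of _ "\<lambda>t. \<phi> (h t)"] conjI allI impI ballI; simp only: persistence_module.simps X')
    show "\<phi> (h t) \<in> module_iso F (homology F (X (h t)) i) (pm_space ?N t)" for t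
      using iso[of "h t"] unfolding space .
    show "\<phi> (h t) (homology_inclusion F (X (h t)) i x) = pm_map ?N s t (\<phi> (h s) x)"
      if "s \<le> t" "x \<in> carrier (homology F (X (h s)) i)" for s t x
      using nat[OF monoD[OF \<open>mono h\<close> that(1)] that(2)] unfolding map .
  qed
  then show ?thesis using PH by (simp add: is_PH_deg_def)
qed

text \<open>If two functions on a finite set order it in the same way, a monotone step function
  matches their sublevel sets: it sends \<open>t\<close> to the largest value of \<open>u\<close> on the sublevel
  set of \<open>v\<close>, and below all values of \<open>u\<close> if that sublevel set is empty.\<close>

lemma sublevel_reparametrization:
  fixes u v :: "'l \<Rightarrow> real"
  assumes "finite L" and ord: "\<And>a b. a \<in> L \<Longrightarrow> b \<in> L \<Longrightarrow> u a \<le> u b \<longleftrightarrow> v a \<le> v b"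
  obtains h :: "real \<Rightarrow> real" where "mono h" and "\<And>a t. a \<in> L \<Longrightarrow> u a \<le> h t \<longleftrightarrow> v a \<le> t"
proof
  define S where "S t = {a\<in>L. v a \<le> t}" for t
  \<comment> \<open>Inserting \<open>0\<close> makes the minimum meaningful for empty \<open>L\<close>, too.\<close>
  define h where "h t = (if S t = {} then Min (insert 0 (u ` L)) - 1 else Max (u ` S t))" for t
  have fin: "finite (S t)" for t using assms(1) by (simp add: S_def)
  show iff: "u a \<le> h t \<longleftrightarrow> v a \<le> t" if "a \<in> L" for a t
  proof (cases "S t = {}")
    case True
    have "Min (insert 0 (u ` L)) \<le> u a" using assms(1) that by simp
    then show ?thesis using True that by (auto simp: h_def S_def)
  next
    case False
    then have "u a \<le> h t \<longleftrightarrow> (\<exists>b\<in>S t. u a \<le> u b)" using fin by (simp add: h_def Max_ge_iff)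
    also have "\<dots> \<longleftrightarrow> v a \<le> t"
      using ord that by (auto simp: S_def intro: order_trans)
    finally show ?thesis .
  qed
  show "mono h"
  proof (rule monoI)
    fix s t :: real assume "s \<le> t"
    show "h s \<le> h t"
    proof (cases "S s = {}")
      case False
      have "u a \<le> h t" if "a \<in> S s" for a using iff[of a t] that \<open>s \<le> t\<close> by (simp add: S_def)
      then show ?thesis using False fin by (simp add: h_def)
    next
      case True
      have "Min (insert 0 (u ` L)) \<le> u a" if "a \<in> L" for a using assms(1) that by simp
      then have "Min (insert 0 (u ` L)) \<le> Max (u ` S t)" if "S t \<noteq> {}"
        using fin that by (simp add: Max_ge_iff) (auto simp: S_def)
      then show ?thesis using True by (cases "S t = {}") (simp_all add: h_def)
    qed
  qed
qed

text \<open>Membership in a nonempty fibre is decided by finitely many comparisons: how the entry times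
  of the simplices compare to each other, and how they compare to the entry times at one point
  \<open>P0\<close> of the fibre. The former guarantee that a monotone reparametrization matches the two
  filtrations; the latter, that it preserves the bars, since at \<open>P0\<close> a bar can start or end
  only at an entry time. The functions \<open>w\<close> are squared entry times, which keeps square roots
  out of the conditions on \<open>P\<close>.\<close>

theorem semialgebraic_PH_fibre:
  fixes F :: "('a, 'm) ring_scheme"
    and w :: "'n::{finite,linorder} set \<Rightarrow> 'p::euclidean_space \<Rightarrow> real"
  assumes "field F" and "semialgebraic S"
    and X: "\<And>P t. X P t = {\<sigma>. \<sigma> \<noteq> {} \<and> sqrt (w \<sigma> P) \<le> t}"
    and le: "\<And>\<sigma> \<tau>. \<sigma> \<noteq> {} \<Longrightarrow> \<tau> \<noteq> {} \<Longrightarrow> semialgebraic {P. w \<sigma> P \<le> w \<tau> P}"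
    and le_const: "\<And>\<sigma> e. \<sigma> \<noteq> {} \<Longrightarrow> semialgebraic {P. w \<sigma> P \<le> e}"
    and ge_const: "\<And>\<sigma> e. \<sigma> \<noteq> {} \<Longrightarrow> semialgebraic {P. e \<le> w \<sigma> P}"
  shows "semialgebraic {P \<in> S. \<forall>i\<in>J. is_PH_deg F (X P) i (D i)}" (is "semialgebraic ?T")
proof (cases "?T = {}")
  case True
  show ?thesis unfolding True by (rule semialgebraic_empty)
next
  case False
  then obtain P0 where P0: "\<And>i. i \<in> J \<Longrightarrow> is_PH_deg F (X P0) i (D i)" by auto
  \<comment> \<open>The index \<open>(True, \<sigma>)\<close> stands for the squared entry time of \<open>\<sigma>\<close> in the moving
    filtration, and \<open>(False, \<sigma>)\<close> for the constant one at \<open>P0\<close>.\<close>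
  define u where "u P a = w (snd a) (if fst a then P else P0)" for P and a :: "bool \<times> 'n set"
  let ?L = "(UNIV :: bool set) \<times> {\<sigma>::'n set. \<sigma> \<noteq> {}}"
  show ?thesis
  proof (rule semialgebraic_if_decided)
    show "finite (?L \<times> ?L)" by (intro finite_cartesian_product finite)
    show "semialgebraic {P. u P (fst p) \<le> u P (snd p)}" if p: "p \<in> ?L \<times> ?L" for p
    proof -
      obtain x \<sigma> y \<tau> where [simp]: "p = ((x, \<sigma>), (y, \<tau>))" by (metis surj_pair)
      show ?thesis
        using p le le_const ge_const semialgebraic_UNIV semialgebraic_empty
        by (cases x; cases y; cases "w \<sigma> P0 \<le> w \<tau> P0") (auto simp: u_def)
    qed
    show "semialgebraic S" "?T \<subseteq> S" using assms(2) by auto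
    fix P P'
    assume P: "P \<in> ?T" and P': "P' \<in> S"
      and same: "\<forall>p\<in>?L \<times> ?L. u P (fst p) \<le> u P (snd p) \<longleftrightarrow> u P' (fst p) \<le> u P' (snd p)"
    have "sqrt (u P a) \<le> sqrt (u P b) \<longleftrightarrow> sqrt (u P' a) \<le> sqrt (u P' b)"
      if "a \<in> ?L" "b \<in> ?L" for a b
      using same that by (metis (no_types, lifting) SigmaI fst_conv real_sqrt_le_iff snd_conv)
    moreover have "finite ?L" by (intro finite_cartesian_product finite)
    ultimately obtain h where "mono h"
      and h: "\<And>a t. a \<in> ?L \<Longrightarrow> sqrt (u P a) \<le> h t \<longleftrightarrow> sqrt (u P' a) \<le> t"
      using sublevel_reparametrization[of ?L "\<lambda>a. sqrt (u P a)" "\<lambda>a. sqrt (u P' a)"] by blast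
    have moving: "X P' t = X P (h t)" for t
      using h[of "(True, _)" t] by (auto simp: X u_def)
    have fixed: "X P0 (h t) = X P0 t" for t
      using h[of "(False, _)" t] by (auto simp: X u_def)
    have "is_PH_deg F (X P') i (D i)" if "i \<in> J" for i
    proof (rule is_PH_deg_reindex[where X = "X P" and h = h])
      show "mono h" "\<And>t. X P' t = X P (h t)" by fact+
      show "is_PH_deg F (X P) i (D i)" using P that by blast
      show "h t \<in> I \<longleftrightarrow> t \<in> I" if "D i I \<noteq> 0" for I t
        using bar_respects_constancy[OF assms(1) P0[OF \<open>i \<in> J\<close>] that fixed] .
    qed
    then show "P' \<in> ?T" using P' by blast
  qed
qed


section \<open>Distances between the points of a configuration\<close>

lemma real_polynomial_function_inner_points:
  "real_polynomial_function (\<lambda>P :: real^'d^'n. P $ i \<bullet> P $ j)"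
proof -
  have coord: "real_polynomial_function (\<lambda>P :: real^'d^'n. P $ i $ k)" for i k
    by (intro real_polynomial_function.intros(1) bounded_linear_compose[OF bounded_linear_vec_nth]
        bounded_linear_vec_nth)
  show ?thesis
    unfolding inner_vec_def inner_real_def
    by (intro real_polynomial_function_sum real_polynomial_function.intros(4) coord) simp
qed

lemma real_polynomial_function_sqdist_points:
  "real_polynomial_function (\<lambda>P :: real^'d^'n. (norm (P $ i - P $ j))\<^sup>2)"
proof -
  have "(\<lambda>P :: real^'d^'n. (norm (P $ i - P $ j))\<^sup>2) =
      (\<lambda>P. P $ i \<bullet> P $ i - 2 * (P $ i \<bullet> P $ j) + P $ j \<bullet> P $ j)"
    by (simp add: fun_eq_iff power2_norm_eq_inner inner_diff_left inner_diff_right inner_commute)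
  moreover have "real_polynomial_function \<dots>"
    by (intro real_polynomial_function.intros(2,3,4) real_polynomial_function_diff
        real_polynomial_function_inner_points)
  ultimately show ?thesis by simp
qed

lemma semialgebraic_PC: "semialgebraic (PC :: (real^'d^'n) set)"
proof -
  have "semialgebraic {P :: real^'d^'n. \<forall>p \<in> {(i, j). i \<noteq> j}. 0 < (norm (P $ fst p - P $ snd p))\<^sup>2}"
    by (intro semialgebraic_Ball semialgebraic_gt_0 real_polynomial_function_sqdist_points) simp
  then show ?thesis by (simp add: PC_def)
qed


section \<open>The Vietoris-Rips filtration\<close>

definition half_diameter_sq :: "'n::finite set \<Rightarrow> real^'d^'n \<Rightarrow> real" where
  "half_diameter_sq \<sigma> P = Max ((\<lambda>p. (norm (P $ fst p - P $ snd p) / 2)\<^sup>2) ` (\<sigma> \<times> \<sigma>))"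

lemma vietoris_rips_eq_sublevel:
  "vietoris_rips P r = {\<sigma>. \<sigma> \<noteq> {} \<and> sqrt (half_diameter_sq \<sigma> P) \<le> r}"
proof -
  have "sqrt (half_diameter_sq \<sigma> P) \<le> r \<longleftrightarrow> (\<forall>i\<in>\<sigma>. \<forall>j\<in>\<sigma>. norm (P $ i - P $ j) \<le> 2 * r)"
    if "\<sigma> \<noteq> {}" for \<sigma>
  proof -
    let ?d = "\<lambda>p. (norm (P $ fst p - P $ snd p) / 2)\<^sup>2"
    have "sqrt (half_diameter_sq \<sigma> P) = Max (sqrt ` ?d ` (\<sigma> \<times> \<sigma>))"
      unfolding half_diameter_sq_def using that
      by (intro mono_Max_commute) (auto simp: mono_def)
    also have "\<dots> \<le> r \<longleftrightarrow> (\<forall>i\<in>\<sigma>. \<forall>j\<in>\<sigma>. norm (P $ i - P $ j) \<le> 2 * r)"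
      using that by (subst Max_le_iff) (auto simp: mult.commute[of r 2])
    finally show ?thesis .
  qed
  then show ?thesis by (auto simp: vietoris_rips_def)
qed

lemma semialgebraic_Max_le_Max:
  assumes "finite I" "I \<noteq> {}" "finite J" "J \<noteq> {}"
    and "\<And>i. i \<in> I \<Longrightarrow> real_polynomial_function (\<lambda>x. f x i)"
    and "\<And>j. j \<in> J \<Longrightarrow> real_polynomial_function (\<lambda>x. g x j)"
  shows "semialgebraic {x. Max (f x ` I) \<le> Max (g x ` J)}"
proof -
  have "{x. Max (f x ` I) \<le> Max (g x ` J)} = {x. \<forall>i\<in>I. \<exists>j\<in>J. 0 \<le> g x j - f x i}"
  proof -
    have "Max (f x ` I) \<le> Max (g x ` J) \<longleftrightarrow> (\<forall>i\<in>I. f x i \<le> Max (g x ` J))" for x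
      using assms by (subst Max_le_iff) auto
    moreover have "y \<le> Max (g x ` J) \<longleftrightarrow> (\<exists>j\<in>J. 0 \<le> g x j - y)" for x y
      using assms by (subst Max_ge_iff) auto
    ultimately show ?thesis by simp
  qed
  also have "semialgebraic \<dots>"
    using assms by (intro semialgebraic_Ball semialgebraic_Bex semialgebraic_ge_0
        real_polynomial_function_diff)
  finally show ?thesis .
qed

lemma semialgebraic_half_diameter_sq:
  fixes \<sigma> \<tau> :: "'n::finite set"
  assumes "\<sigma> \<noteq> {}"
  shows "\<tau> \<noteq> {} \<Longrightarrow> semialgebraic {P :: real^'d^'n. half_diameter_sq \<sigma> P \<le> half_diameter_sq \<tau> P}"
    and "semialgebraic {P :: real^'d^'n. half_diameter_sq \<sigma> P \<le> e}"
    and "semialgebraic {P :: real^'d^'n. e \<le> half_diameter_sq \<sigma> P}"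
proof -
  let ?d = "\<lambda>(P :: real^'d^'n) p. (norm (P $ fst p - P $ snd p) / 2)\<^sup>2"
  have poly: "real_polynomial_function (\<lambda>P. ?d P p)" for p
    unfolding power_divide
    by (intro real_polynomial_function_divide real_polynomial_function_sqdist_points)
  note poly_const = real_polynomial_function.intros(2)
  show "semialgebraic {P :: real^'d^'n. half_diameter_sq \<sigma> P \<le> half_diameter_sq \<tau> P}" if "\<tau> \<noteq> {}"
    unfolding half_diameter_sq_def
    by (rule semialgebraic_Max_le_Max) (use assms that poly in auto)
  have "semialgebraic {P. Max (?d P ` (\<sigma> \<times> \<sigma>)) \<le> Max ((\<lambda>_::unit. e) ` UNIV)}"
    by (rule semialgebraic_Max_le_Max) (use assms poly poly_const in auto)
  then show "semialgebraic {P :: real^'d^'n. half_diameter_sq \<sigma> P \<le> e}"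
    by (simp add: half_diameter_sq_def)
  have "semialgebraic {P. Max ((\<lambda>_::unit. e) ` UNIV) \<le> Max (?d P ` (\<sigma> \<times> \<sigma>))}"
    by (rule semialgebraic_Max_le_Max) (use assms poly poly_const in auto)
  then show "semialgebraic {P :: real^'d^'n. e \<le> half_diameter_sq \<sigma> P}"
    by (simp add: half_diameter_sq_def)
qed


section \<open>The Cech filtration\<close>

definition enclosing_radius_sq :: "'n set \<Rightarrow> real^'d^'n \<Rightarrow> real" where
  "enclosing_radius_sq \<sigma> P = Inf {R. \<exists>q. \<forall>i\<in>\<sigma>. (norm (P $ i - q))\<^sup>2 \<le> R}"

text \<open>The optimality conditions for the smallest ball around the points indexed by \<open>\<sigma>\<close>: the
  center \<open>q = (\<Sum>i. l i *\<^sub>R P $ i)\<close> is a convex combination of points \<open>P $ i\<close> with \<open>i \<in> A\<close>,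
  which all lie on the bounding sphere. In terms of \<open>s = R - (norm q)\<^sup>2\<close>, where \<open>R\<close> is the
  squared radius, the condition \<open>(norm (P $ j - q))\<^sup>2 \<le> R\<close> has no quadratic term in \<open>q\<close> left,
  so for fixed \<open>P\<close> and \<open>A\<close> the conditions are affine in the unknowns \<open>l\<close> and \<open>s\<close>.\<close>

definition enclosing_certificate ::
  "real^'d^'n::finite \<Rightarrow> 'n set \<Rightarrow> 'n set \<Rightarrow> ('n \<Rightarrow> real) \<Rightarrow> real \<Rightarrow> bool" where
  "enclosing_certificate P \<sigma> A l s \<longleftrightarrow>
    (\<forall>i. 0 \<le> l i) \<and> (\<forall>i\<in>- A. l i \<le> 0) \<and> 0 \<le> (\<Sum>i\<in>UNIV. l i) - 1 \<and> 0 \<le> 1 - (\<Sum>i\<in>UNIV. l i) \<and>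
    (\<forall>j\<in>\<sigma>. 0 \<le> s - (P $ j \<bullet> P $ j - 2 * (\<Sum>i\<in>UNIV. (P $ j \<bullet> P $ i) * l i))) \<and>
    (\<forall>j\<in>A. 0 \<le> P $ j \<bullet> P $ j - 2 * (\<Sum>i\<in>UNIV. (P $ j \<bullet> P $ i) * l i) - s)"

text \<open>On a certificate, \<open>(norm q)\<^sup>2\<close> can be evaluated with the equations for the points of
  \<open>A\<close>, and the squared radius becomes affine in \<open>l\<close> and \<open>s\<close>, too.\<close>

definition certified_radius_sq :: "real^'d^'n::finite \<Rightarrow> ('n \<Rightarrow> real) \<Rightarrow> real \<Rightarrow> real" where
  "certified_radius_sq P l s = (\<Sum>i\<in>UNIV. (P $ i \<bullet> P $ i) * l i) / 2 + s / 2"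

text \<open>The parallel axis theorem: around their weighted mean, weighted points have the smallest
  moment of inertia.\<close>

lemma sum_weighted_sqdist:
  fixes p :: "'n::finite \<Rightarrow> 'v::real_inner"
  assumes "(\<Sum>i\<in>UNIV. l i) = 1"
  defines "q \<equiv> \<Sum>i\<in>UNIV. l i *\<^sub>R p i"
  shows "(\<Sum>i\<in>UNIV. l i * (norm (p i - z))\<^sup>2) = (\<Sum>i\<in>UNIV. (p i \<bullet> p i) * l i) - q \<bullet> q + (norm (q - z))\<^sup>2"
proof -
  have "(\<Sum>i\<in>UNIV. l i * (norm (p i - z))\<^sup>2) =
      (\<Sum>i\<in>UNIV. (p i \<bullet> p i) * l i - 2 * ((l i *\<^sub>R p i) \<bullet> z) + l i * (z \<bullet> z))"
    by (intro sum.cong refl)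
      (simp add: power2_norm_eq_inner inner_diff_left inner_diff_right inner_commute algebra_simps)
  also have "\<dots> = (\<Sum>i\<in>UNIV. (p i \<bullet> p i) * l i) - 2 * (q \<bullet> z) + (\<Sum>i\<in>UNIV. l i) * (z \<bullet> z)"
    by (simp add: sum.distrib sum_subtractf q_def inner_sum_left sum_distrib_left sum_distrib_right)
  finally show ?thesis
    using assms(1)
    by (simp add: power2_norm_eq_inner inner_diff_left inner_diff_right inner_commute)
qed

text \<open>A certificate proves both bounds: its center encloses the points within the certified
  radius, and its weights average the squared distances from any competing center \<open>z\<close> to at
  least the certified value.\<close>

lemma enclosing_certificate_sound:
  assumes cert: "enclosing_certificate P \<sigma> A l s" and "A \<subseteq> \<sigma>"
  shows "(\<exists>q. \<forall>i\<in>\<sigma>. (norm (P $ i - q))\<^sup>2 \<le> R) \<longleftrightarrow> certified_radius_sq P l s \<le> R"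
proof -
  define q where "q = (\<Sum>i\<in>UNIV. l i *\<^sub>R P $ i)"
  have inner_q: "(\<Sum>i\<in>UNIV. (x \<bullet> P $ i) * l i) = x \<bullet> q" for x
    by (simp add: q_def inner_sum_right mult.commute)
  have l: "0 \<le> l i" "i \<notin> A \<Longrightarrow> l i = 0" "(\<Sum>i\<in>UNIV. l i) = 1" for i
    using cert by (auto simp: enclosing_certificate_def intro: antisym)
  have inside: "P $ j \<bullet> P $ j - 2 * (P $ j \<bullet> q) \<le> s" if "j \<in> \<sigma>" for j
    using cert that unfolding enclosing_certificate_def inner_q by auto
  have sphere: "P $ j \<bullet> P $ j - 2 * (P $ j \<bullet> q) = s" if "j \<in> A" for j
    using cert that inside[of j] \<open>A \<subseteq> \<sigma>\<close>
    unfolding enclosing_certificate_def inner_q by force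
  define W where "W = (\<Sum>i\<in>UNIV. (P $ i \<bullet> P $ i) * l i)"
  have "W - 2 * (q \<bullet> q) = W - 2 * (\<Sum>i\<in>UNIV. (q \<bullet> P $ i) * l i)"
    by (simp only: inner_q)
  also have "\<dots> = (\<Sum>i\<in>UNIV. l i * (P $ i \<bullet> P $ i - 2 * (P $ i \<bullet> q)))"
    by (simp add: W_def right_diff_distrib sum_subtractf sum_distrib_left inner_commute mult_ac)
  also have "\<dots> = (\<Sum>i\<in>UNIV. l i * s)"
    using l sphere by (intro sum.cong refl) (metis mult_eq_0_iff)
  also have "\<dots> = s" using l by (simp flip: sum_distrib_right)
  finally have s: "s = W - 2 * (q \<bullet> q)" by simp
  then have V: "certified_radius_sq P l s = s + q \<bullet> q" "certified_radius_sq P l s = W - q \<bullet> q"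
    by (auto simp: certified_radius_sq_def W_def diff_divide_distrib)
  show ?thesis
  proof
    assume "certified_radius_sq P l s \<le> R"
    moreover have "(norm (P $ i - q))\<^sup>2 \<le> certified_radius_sq P l s" if "i \<in> \<sigma>" for i
      using inside[OF that] unfolding V
      by (simp add: power2_norm_eq_inner inner_diff_left inner_diff_right inner_commute)
    ultimately show "\<exists>q. \<forall>i\<in>\<sigma>. (norm (P $ i - q))\<^sup>2 \<le> R" by (meson order_trans)
  next
    assume "\<exists>q. \<forall>i\<in>\<sigma>. (norm (P $ i - q))\<^sup>2 \<le> R"
    then obtain z where z: "\<forall>i\<in>\<sigma>. (norm (P $ i - z))\<^sup>2 \<le> R" ..
    have "certified_radius_sq P l s \<le> (\<Sum>i\<in>UNIV. l i * (norm (P $ i - z))\<^sup>2)"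
      unfolding V(2) by (subst sum_weighted_sqdist) (auto simp: l W_def q_def)
    also have "\<dots> \<le> (\<Sum>i\<in>UNIV. l i * R)"
    proof (rule sum_mono)
      fix i show "l i * (norm (P $ i - z))\<^sup>2 \<le> l i * R"
        using l(1,2)[of i] z \<open>A \<subseteq> \<sigma>\<close> by (cases "i \<in> A") (auto intro!: mult_left_mono)
    qed
    also have "\<dots> = R" using l by (simp flip: sum_distrib_right)
    finally show "certified_radius_sq P l s \<le> R" .
  qed
qed

text \<open>Certificates come from the dual problem, to maximize over the simplex of weights on
  \<open>\<sigma>\<close> the average squared distance of the points from their weighted mean. At a maximum,
  shifting weight towards a single point \<open>P $ j\<close> gains nothing to first order, which says
  that \<open>P $ j\<close> is no farther from the mean \<open>q\<close> than on average; hence all points that carry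
  weight are at the same distance from \<open>q\<close>.\<close>

lemma enclosing_certificate_exists:
  fixes P :: "real^'d^'n::finite"
  assumes "\<sigma> \<noteq> {}"
  obtains A l s where "A \<subseteq> \<sigma>" "enclosing_certificate P \<sigma> A l s"
proof -
  define S where "S = {x::real^'n. (\<forall>i. 0 \<le> x $ i) \<and> (\<forall>i\<in>-\<sigma>. x $ i = 0) \<and> (\<Sum>i\<in>UNIV. x $ i) = 1}"
  define q where "q x = (\<Sum>i\<in>UNIV. x $ i *\<^sub>R P $ i)" for x :: "real^'n"
  define g where "g x = (\<Sum>i\<in>UNIV. (P $ i \<bullet> P $ i) * x $ i) - q x \<bullet> q x" for x :: "real^'n"
  have "S \<subseteq> cbox 0 1"
  proof
    fix x assume x: "x \<in> S"
    have "x $ i \<le> 1" for i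
      using member_le_sum[of i UNIV "\<lambda>i. x $ i"] x by (simp add: S_def)
    then show "x \<in> cbox 0 1" using x by (simp add: S_def mem_box_cart)
  qed
  moreover have "closed S"
    unfolding S_def Ball_def
    by (intro closed_Collect_conj closed_Collect_all closed_Collect_imp open_Collect_const
        closed_Collect_le closed_Collect_eq continuous_intros)
  ultimately have "compact S"
    using bounded_cbox bounded_subset compact_eq_bounded_closed by blast
  moreover obtain k where "k \<in> \<sigma>" using assms by blast
  then have "axis k 1 \<in> S" by (auto simp: S_def axis_def)
  moreover have "continuous_on S g"
    unfolding g_def q_def by (intro continuous_intros)
  ultimately obtain x where x: "x \<in> S" and max: "\<And>y. y \<in> S \<Longrightarrow> g y \<le> g x"
    using continuous_attains_sup[of S g] by blast
  have xS: "0 \<le> x $ i" "i \<notin> \<sigma> \<Longrightarrow> x $ i = 0" "(\<Sum>i\<in>UNIV. x $ i) = 1" for i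
    using x by (auto simp: S_def)
  have near: "(norm (P $ j - q x))\<^sup>2 \<le> g x" if j: "j \<in> \<sigma>" for j
  proof -
    let ?e = "(norm (P $ j - q x))\<^sup>2"
    \<comment> \<open>The gain \<open>g y - g x\<close> of the shift by \<open>t\<close>, divided by \<open>t\<close>.\<close>
    have shift: "?e - g x - t * ?e \<le> 0" if t: "0 < t" "t < 1" for t
    proof -
      define y where "y = (1 - t) *\<^sub>R x + t *\<^sub>R axis j 1"
      have yi: "y $ i = (1 - t) * x $ i + t * (if i = j then 1 else 0)" for i
        by (simp add: y_def axis_def)
      have sum_y: "(\<Sum>i\<in>UNIV. c i * y $ i) = (1 - t) * (\<Sum>i\<in>UNIV. c i * x $ i) + t * c j" for c :: "'n \<Rightarrow> real"
        by (simp add: yi distrib_left sum.distrib sum_distrib_left mult_ac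
            if_distrib[of "\<lambda>a. _ * a"] cong: if_cong)
      have "y \<in> S"
        using xS t j sum_y[of "\<lambda>_. 1"] by (auto simp: S_def yi)
      moreover have qy: "q y = (1 - t) *\<^sub>R q x + t *\<^sub>R P $ j"
        by (simp add: q_def yi scaleR_add_left sum.distrib scaleR_sum_right
            if_distrib[of "\<lambda>a. a *\<^sub>R _"] if_distrib[of "\<lambda>a. _ * a"] cong: if_cong)
      have "g y = g x + t * (?e - g x - t * ?e)"
        unfolding g_def qy sum_y
        by (simp add: power2_norm_eq_inner inner_diff_left inner_diff_right inner_add_left
            inner_add_right inner_commute algebra_simps)
      ultimately have "t * (?e - g x - t * ?e) \<le> 0" using max by fastforce
      then show ?thesis using t by (simp add: mult_le_0_iff)
    qed
    have "((\<lambda>t. ?e - g x - t * ?e) \<longlongrightarrow> ?e - g x - 0 * ?e) (at_right 0)"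
      by (intro tendsto_intros)
    moreover have "eventually (\<lambda>t. ?e - g x - t * ?e \<le> 0) (at_right 0)"
      by (rule eventually_at_rightI[of 0 1]) (use shift in auto)
    ultimately have "?e - g x - 0 * ?e \<le> 0"
      by (intro tendsto_upperbound) auto
    then show ?thesis by simp
  qed
  define A where "A = {j. x $ j \<noteq> 0}"
  define s where "s = g x - q x \<bullet> q x"
  have "A \<subseteq> \<sigma>" using xS by (auto simp: A_def)
  have "(\<Sum>i\<in>UNIV. x $ i * (norm (P $ i - q x))\<^sup>2) = g x"
    by (subst sum_weighted_sqdist) (simp_all add: xS g_def q_def)
  then have "(\<Sum>i\<in>UNIV. x $ i * (g x - (norm (P $ i - q x))\<^sup>2)) = 0"
    using xS(3) by (simp add: right_diff_distrib sum_subtractf flip: sum_distrib_right)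
  moreover have "0 \<le> x $ i * (g x - (norm (P $ i - q x))\<^sup>2)" for i
    using near[of i] xS(1,2)[of i] by (cases "i \<in> \<sigma>") auto
  ultimately have "x $ i * (g x - (norm (P $ i - q x))\<^sup>2) = 0" for i
    by (simp add: sum_nonneg_eq_0_iff)
  then have far: "(norm (P $ j - q x))\<^sup>2 = g x" if "j \<in> A" for j
    using that by (simp add: A_def) (metis eq_iff_diff_eq_0 mult_eq_0_iff)
  have inner_q: "(\<Sum>i\<in>UNIV. (z \<bullet> P $ i) * x $ i) = z \<bullet> q x" for z
    by (simp add: q_def inner_sum_right mult.commute)
  have sq: "P $ j \<bullet> P $ j - 2 * (P $ j \<bullet> q x) = (norm (P $ j - q x))\<^sup>2 - q x \<bullet> q x" for j
    by (simp add: power2_norm_eq_inner inner_diff_left inner_diff_right inner_commute)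
  have "enclosing_certificate P \<sigma> A (\<lambda>i. x $ i) s"
    unfolding enclosing_certificate_def inner_q sq s_def
    using near far xS by (auto simp: A_def)
  with \<open>A \<subseteq> \<sigma>\<close> show thesis by (rule that)
qed

lemma enclosing_radius_sq_eq_certified:
  assumes "enclosing_certificate P \<sigma> A l s" "A \<subseteq> \<sigma>"
  shows "enclosing_radius_sq \<sigma> P = certified_radius_sq P l s"
proof -
  have "{R. \<exists>q. \<forall>i\<in>\<sigma>. (norm (P $ i - q))\<^sup>2 \<le> R} = {certified_radius_sq P l s..}"
    using enclosing_certificate_sound[OF assms] by (auto simp: set_eq_iff)
  then show ?thesis by (simp add: enclosing_radius_sq_def)
qed

lemma cech_eq_sublevel:
  fixes P :: "real^'d^'n::finite"
  shows "cech P r = {\<sigma>. \<sigma> \<noteq> {} \<and> sqrt (enclosing_radius_sq \<sigma> P) \<le> r}"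
proof -
  have "(\<exists>q. \<forall>i\<in>\<sigma>. norm (P $ i - q) \<le> r) \<longleftrightarrow> sqrt (enclosing_radius_sq \<sigma> P) \<le> r" if ne: "\<sigma> \<noteq> {}" for \<sigma>
  proof -
    obtain A l s where "A \<subseteq> \<sigma>" and cert: "enclosing_certificate P \<sigma> A l s"
      using enclosing_certificate_exists[OF ne] .
    then have ball: "(\<exists>q. \<forall>i\<in>\<sigma>. (norm (P $ i - q))\<^sup>2 \<le> R) \<longleftrightarrow> enclosing_radius_sq \<sigma> P \<le> R" for R
      using enclosing_certificate_sound[OF cert] enclosing_radius_sq_eq_certified[OF cert] by simp
    have nonneg: "0 \<le> enclosing_radius_sq \<sigma> P"
      using ball[of "enclosing_radius_sq \<sigma> P"] that
      by (metis all_not_in_conv order_refl order_trans zero_le_power2)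
    show ?thesis
    proof (cases "0 \<le> r")
      case True
      then have "norm z \<le> r \<longleftrightarrow> (norm z)\<^sup>2 \<le> r\<^sup>2" for z :: "real^'d" by (simp add: abs_le_square_iff[symmetric])
      then show ?thesis using ball[of "r\<^sup>2"] True nonneg
        by (metis real_sqrt_abs real_sqrt_le_iff abs_of_nonneg)
    next
      case False
      then have "\<not> norm z \<le> r" for z :: "real^'d" using norm_ge_zero[of z] by linarith
      moreover have "\<not> sqrt (enclosing_radius_sq \<sigma> P) \<le> r"
        using False nonneg real_sqrt_ge_zero[OF nonneg] by linarith
      ultimately show ?thesis using that by blast
    qed
  qed
  then show ?thesis by (auto simp: cech_def)
qed

lemma enclosing_certificate_system:
  fixes L :: "'n::finite \<Rightarrow> 'k::finite" and s :: 'k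
  obtains \<Phi> :: "(real^'d^'n \<Rightarrow> ('k \<Rightarrow> real) \<Rightarrow> real) set"
  where "finite \<Phi>" "\<And>f. f \<in> \<Phi> \<Longrightarrow> parametric_affine f"
    and "\<And>P x. enclosing_certificate P \<sigma> A (\<lambda>i. x (L i)) (x s) \<longleftrightarrow> (\<forall>f\<in>\<Phi>. 0 \<le> f P x)"
proof
  let ?r = "\<lambda>j (P :: real^'d^'n) x. P $ j \<bullet> P $ j - 2 * (\<Sum>i\<in>UNIV. (P $ j \<bullet> P $ i) * x (L i))"
  let ?\<Phi> = "range (\<lambda>i P x. x (L i)) \<union> (\<lambda>i P x. - 1 * x (L i)) ` (- A) \<union>
    {\<lambda>P x. (\<Sum>i\<in>UNIV. x (L i)) - 1, \<lambda>P x. 1 - (\<Sum>i\<in>UNIV. x (L i))} \<union>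
    (\<lambda>j P x. x s - ?r j P x) ` \<sigma> \<union> (\<lambda>j P x. ?r j P x - x s) ` A"
  have poly_const: "real_polynomial_function (\<lambda>P :: real^'d^'n. c)" for c
    by (rule real_polynomial_function.intros(2))
  have r: "parametric_affine (?r j)" for j
    by (intro parametric_affine_diff parametric_affine_scale parametric_affine_sum
        parametric_affine_parameter parametric_affine_variable poly_const
        real_polynomial_function_inner_points) simp
  show "finite ?\<Phi>" by simp
  show "parametric_affine f" if "f \<in> ?\<Phi>" for f
    using that
    by (elim UnE imageE insertE emptyE; simp only:)
      (intro parametric_affine_diff parametric_affine_scale parametric_affine_sum r
        parametric_affine_parameter parametric_affine_variable poly_const finite)+
  show "enclosing_certificate P \<sigma> A (\<lambda>i. x (L i)) (x s) \<longleftrightarrow> (\<forall>f\<in>?\<Phi>. 0 \<le> f P x)" for P x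
    by (simp add: enclosing_certificate_def ball_Un) blast
qed

text \<open>Squared radii are not polynomial in \<open>P\<close>, but once both are expressed by certificates,
  every affine inequality between them becomes an affine condition on the unknowns, which can be
  eliminated. Suitable coefficients give the comparison of two radii and the comparisons of a
  radius with a constant.\<close>

lemma semialgebraic_enclosing_radius_sq_combination:
  fixes \<sigma> \<tau> :: "'n::finite set"
  assumes "\<sigma> \<noteq> {}" "\<tau> \<noteq> {}"
  shows "semialgebraic {P :: real^'d^'n.
    0 \<le> \<alpha> * enclosing_radius_sq \<sigma> P + \<beta> * enclosing_radius_sq \<tau> P + \<gamma>}"
proof -
  \<comment> \<open>The unknowns are two certificates, with \<open>None\<close> in place of \<open>s\<close>.\<close>
  let ?l = "\<lambda>b (x :: bool \<times> 'n option \<Rightarrow> real) i. x (b, Some i)"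
  let ?s = "\<lambda>b (x :: bool \<times> 'n option \<Rightarrow> real). x (b, None)"
  let ?R = "\<lambda>b (P :: real^'d^'n) x. certified_radius_sq P (?l b x) (?s b x)"
  let ?val = "\<lambda>P x. \<alpha> * ?R True P x + \<beta> * ?R False P x + \<gamma>"
  let ?sol = "\<lambda>A B P x. enclosing_certificate P \<sigma> A (?l True x) (?s True x) \<and>
      enclosing_certificate P \<tau> B (?l False x) (?s False x) \<and> 0 \<le> ?val P x"
  have poly_const: "real_polynomial_function (\<lambda>P :: real^'d^'n. c)" for c
    by (rule real_polynomial_function.intros(2))
  have half: "?R b = (\<lambda>P x. 1 / 2 * ((\<Sum>i\<in>UNIV. (P $ i \<bullet> P $ i) * ?l b x i) + ?s b x))" for b
    by (simp add: certified_radius_sq_def fun_eq_iff add_divide_distrib)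
  have "parametric_affine (?R b)" for b
    unfolding half
    by (intro parametric_affine_scale parametric_affine_add parametric_affine_sum
        parametric_affine_variable real_polynomial_function_inner_points poly_const finite)
  then have val: "parametric_affine ?val"
    by (intro parametric_affine_add parametric_affine_scale poly_const
        parametric_affine_parameter)
  have "semialgebraic {P. \<exists>x. ?sol A B P x}" for A B
  proof -
    obtain \<Phi> :: "(real^'d^'n \<Rightarrow> (bool \<times> 'n option \<Rightarrow> real) \<Rightarrow> real) set" where \<Phi>: "finite \<Phi>" "\<And>f. f \<in> \<Phi> \<Longrightarrow> parametric_affine f"
      "\<And>P x. enclosing_certificate P \<sigma> A (?l True x) (?s True x) \<longleftrightarrow> (\<forall>f\<in>\<Phi>. 0 \<le> f P x)"
      using enclosing_certificate_system[of \<sigma> A "\<lambda>i. (True, Some i)" "(True, None)"] by metis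
    obtain \<Psi> :: "(real^'d^'n \<Rightarrow> (bool \<times> 'n option \<Rightarrow> real) \<Rightarrow> real) set" where \<Psi>: "finite \<Psi>" "\<And>f. f \<in> \<Psi> \<Longrightarrow> parametric_affine f"
      "\<And>P x. enclosing_certificate P \<tau> B (?l False x) (?s False x) \<longleftrightarrow> (\<forall>f\<in>\<Psi>. 0 \<le> f P x)"
      using enclosing_certificate_system[of \<tau> B "\<lambda>i. (False, Some i)" "(False, None)"] by metis
    have "semialgebraic {P. \<exists>x. \<forall>f\<in>\<Phi> \<union> \<Psi> \<union> {?val}. 0 \<le> f P x}"
      by (rule semialgebraic_exists_affine_system) (use \<Phi> \<Psi> val in auto)
    moreover have "(\<forall>f\<in>\<Phi> \<union> \<Psi> \<union> {?val}. 0 \<le> f P x) \<longleftrightarrow> ?sol A B P x" for P x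
      unfolding \<Phi>(3) \<Psi>(3) by auto
    ultimately show ?thesis by simp
  qed
  then have "semialgebraic {P. \<exists>p\<in>Pow \<sigma> \<times> Pow \<tau>. \<exists>x. ?sol (fst p) (snd p) P x}"
    by (intro semialgebraic_Bex) auto
  moreover have "(\<exists>p\<in>Pow \<sigma> \<times> Pow \<tau>. \<exists>x. ?sol (fst p) (snd p) P x) \<longleftrightarrow>
      0 \<le> \<alpha> * enclosing_radius_sq \<sigma> P + \<beta> * enclosing_radius_sq \<tau> P + \<gamma>" for P
  proof
    assume "\<exists>p\<in>Pow \<sigma> \<times> Pow \<tau>. \<exists>x. ?sol (fst p) (snd p) P x"
    then obtain A B x where "A \<subseteq> \<sigma>" "B \<subseteq> \<tau>" "?sol A B P x" by auto
    then show "0 \<le> \<alpha> * enclosing_radius_sq \<sigma> P + \<beta> * enclosing_radius_sq \<tau> P + \<gamma>"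
      using enclosing_radius_sq_eq_certified by metis
  next
    assume *: "0 \<le> \<alpha> * enclosing_radius_sq \<sigma> P + \<beta> * enclosing_radius_sq \<tau> P + \<gamma>"
    obtain A l s where A: "A \<subseteq> \<sigma>" "enclosing_certificate P \<sigma> A l s"
      using enclosing_certificate_exists[OF assms(1)] .
    obtain B m t where B: "B \<subseteq> \<tau>" "enclosing_certificate P \<tau> B m t"
      using enclosing_certificate_exists[OF assms(2)] .
    define x where "x = (\<lambda>(b, k). case k of None \<Rightarrow> if b then s else t | Some i \<Rightarrow> if b then l i else m i)"
    have "?sol A B P x"
      using A B * enclosing_radius_sq_eq_certified[OF A(2,1)] enclosing_radius_sq_eq_certified[OF B(2,1)]
      by (simp add: x_def)
    then show "\<exists>p\<in>Pow \<sigma> \<times> Pow \<tau>. \<exists>x. ?sol (fst p) (snd p) P x"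
      using A(1) B(1) by (intro bexI[of _ "(A, B)"] exI[of _ x]) auto
  qed
  ultimately show ?thesis by simp
qed

lemma semialgebraic_enclosing_radius_sq:
  fixes \<sigma> \<tau> :: "'n::finite set"
  assumes "\<sigma> \<noteq> {}"
  shows "\<tau> \<noteq> {} \<Longrightarrow> semialgebraic {P :: real^'d^'n. enclosing_radius_sq \<sigma> P \<le> enclosing_radius_sq \<tau> P}"
    and "semialgebraic {P :: real^'d^'n. enclosing_radius_sq \<sigma> P \<le> e}"
    and "semialgebraic {P :: real^'d^'n. e \<le> enclosing_radius_sq \<sigma> P}"
  using semialgebraic_enclosing_radius_sq_combination[of \<sigma> \<tau> "- 1" 1 0, where 'd = 'd]
    semialgebraic_enclosing_radius_sq_combination[of \<sigma> \<sigma> "- 1" 0 e, where 'd = 'd]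
    semialgebraic_enclosing_radius_sq_combination[of \<sigma> \<sigma> 1 0 "- e", where 'd = 'd] assms
  by (simp_all add: algebra_simps)


section \<open>Fibres of persistent homology\<close>

theorem corollary46:
  fixes F :: "('a, 'm) ring_scheme"
    and D :: "nat \<Rightarrow> interval_multiset"
  assumes "field F" and "full_barcode D"
  shows "semialgebraic {P \<in> (PC :: (real ^ 'd ^ 'n::{finite,linorder}) set). is_PH F (cech P) D}
    \<and> semialgebraic {P \<in> (PC :: (real ^ 'd ^ 'n::{finite,linorder}) set). is_PH F (vietoris_rips P) D}
    \<and> (\<forall>i. semialgebraic {P \<in> (PC :: (real ^ 'd ^ 'n::{finite,linorder}) set). is_PH_deg F (cech P) i (D i)})
    \<and> (\<forall>i. semialgebraic {P \<in> (PC :: (real ^ 'd ^ 'n::{finite,linorder}) set). is_PH_deg F (vietoris_rips P) i (D i)})"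
proof -
  have cech: "semialgebraic {P \<in> (PC :: (real^'d^'n::{finite,linorder}) set). \<forall>i\<in>J. is_PH_deg F (cech P) i (D i)}" for J
    using assms(1) semialgebraic_PC cech_eq_sublevel semialgebraic_enclosing_radius_sq
    by (rule semialgebraic_PH_fibre)
  have rips: "semialgebraic {P \<in> (PC :: (real^'d^'n::{finite,linorder}) set). \<forall>i\<in>J. is_PH_deg F (vietoris_rips P) i (D i)}" for J
    using assms(1) semialgebraic_PC vietoris_rips_eq_sublevel semialgebraic_half_diameter_sq
    by (rule semialgebraic_PH_fibre)
  \<comment> \<open>All degrees at once for \<open>J = UNIV\<close>, and a single degree for \<open>J = {i}\<close>.\<close>
  show ?thesis
    unfolding is_PH_def using cech[of UNIV] rips[of UNIV] cech[of "{i}" for i] rips[of "{i}" for i]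
    by simp
qed

end
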